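(* Let $d \geq 2$ and $0<p<1$, and consider the Gilbert--Steiner problem in $\mathbb{R}^d$ with cost function $c(x)=x^p$. (1) If $d=2$ or $p<1/2$, then every branching point of every solution (minimal flow) has degree exactly three. (2) If $p \geq 1/2$, then there exist data $\mu^+,\mu^-$ for which some solution consists of $d+1$ segments, all adjacent to the same branching point.
   Context: Let $\mu^+,\mu^-$ be finite measures on $\mathbb{R}^d$ (with the Euclidean distance $\rho$) with finite supports and $\mu^+(\mathbb{R}^d)=\mu^-(\mathbb{R}^d)$. A $(\mu^+,\mu^-)$-flow consists of a finite set $V\subset\mathbb{R}^d$ of vertices containing the support of $\mu^+-\mu^-$, a finite set $E$ of unordered pairs $\{x,y\}\subset V$ (edges), and for each edge non-zero reals $m(x,y)=-m(y,x)$, such that $\mu^+-\mu^-=\sum_{\{x,y\}\in E} m(x,y)(\delta_y-\delta_x)$. Its Gilbert functional is $\sum_{\{x,y\}\in E} c(|m(x,y)|)\,\rho(x,y)$. The Gilbert--Steiner problem asks for a $(\mu^+,\mu^-)$-flow minimizing the Gilbert functional with $c(x)=x^p$, $0<p<1$; a minimizer is called a solution or minimal flow. Vertices in $\operatorname{supp}\mu^+\cup\operatorname{supp}\mu^-$ are terminals; other vertices are branching points. Branching points of degree 2 are formally allowed but are understood to be eliminated (by merging their two edges), so degrees of branching points are counted in solutions without degree-2 branching points. *)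

theory Defs
  imports "HOL-Analysis.Analysis"
begin

text \<open>Finite measures with finite support on a space, represented by their
  (nonnegative) point masses.\<close>

definition fin_meas :: "('a \<Rightarrow> real) \<Rightarrow> bool" where
  "fin_meas \<mu> \<longleftrightarrow> (\<forall>x. \<mu> x \<ge> 0) \<and> finite {x. \<mu> x \<noteq> 0}"

definition msupp :: "('a \<Rightarrow> real) \<Rightarrow> 'a set" where
  "msupp \<mu> = {x. \<mu> x \<noteq> 0}"

definition total_mass :: "('a \<Rightarrow> real) \<Rightarrow> real" where
  "total_mass \<mu> = sum \<mu> (msupp \<mu>)"

text \<open>An unordered edge e = {x,y}; we pick an (arbitrary) orientation (x,y).
  All quantities below are independent of the choice since m x y = - m y x.\<close>

definition edge_pair :: "'a set \<Rightarrow> 'a \<times> 'a" where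
  "edge_pair e = (SOME xy. e = {fst xy, snd xy})"

definition flow_div :: "'a set set \<Rightarrow> ('a \<Rightarrow> 'a \<Rightarrow> real) \<Rightarrow> 'a \<Rightarrow> real" where
  "flow_div E m z = (\<Sum>e\<in>E. case edge_pair e of (x, y) \<Rightarrow>
       m x y * ((if z = y then 1 else 0) - (if z = x then 1 else 0)))"

definition is_flow :: "('a \<Rightarrow> real) \<Rightarrow> ('a \<Rightarrow> real) \<Rightarrow> 'a set \<Rightarrow> 'a set set
    \<Rightarrow> ('a \<Rightarrow> 'a \<Rightarrow> real) \<Rightarrow> bool" where
  "is_flow mp mm V E m \<longleftrightarrow>
     finite V \<and> {x. mp x - mm x \<noteq> 0} \<subseteq> V \<and> finite E \<and>
     (\<forall>e\<in>E. e \<subseteq> V \<and> card e = 2) \<and>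
     (\<forall>x y. {x, y} \<in> E \<longrightarrow> m x y \<noteq> 0 \<and> m x y = - m y x) \<and>
     (\<forall>z. mp z - mm z = flow_div E m z)"

definition gilbert :: "real \<Rightarrow> ('a::metric_space) set set \<Rightarrow> ('a \<Rightarrow> 'a \<Rightarrow> real) \<Rightarrow> real" where
  "gilbert p E m = (\<Sum>e\<in>E. case edge_pair e of (x, y) \<Rightarrow> \<bar>m x y\<bar> powr p * dist x y)"

definition minimal_flow :: "real \<Rightarrow> ('a::metric_space \<Rightarrow> real) \<Rightarrow> ('a \<Rightarrow> real) \<Rightarrow> 'a set
    \<Rightarrow> 'a set set \<Rightarrow> ('a \<Rightarrow> 'a \<Rightarrow> real) \<Rightarrow> bool" where
  "minimal_flow p mp mm V E m \<longleftrightarrow> is_flow mp mm V E m \<and>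
     (\<forall>V' E' m'. is_flow mp mm V' E' m' \<longrightarrow> gilbert p E m \<le> gilbert p E' m')"

definition terminals :: "('a \<Rightarrow> real) \<Rightarrow> ('a \<Rightarrow> real) \<Rightarrow> 'a set" where
  "terminals mp mm = msupp mp \<union> msupp mm"

definition branching_point :: "('a \<Rightarrow> real) \<Rightarrow> ('a \<Rightarrow> real) \<Rightarrow> 'a set \<Rightarrow> 'a \<Rightarrow> bool" where
  "branching_point mp mm V v \<longleftrightarrow> v \<in> V \<and> v \<notin> terminals mp mm"

definition degree :: "'a set set \<Rightarrow> 'a \<Rightarrow> nat" where
  "degree E v = card {e\<in>E. v \<in> e}"

end

theory Submission
  imports Defs
begin

text \<open>
  Moving a set \<open>S\<close> of the branches at a branching point \<open>v\<close> of a minimal flow to a nearby new vertex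
  shows that \<open>norm (\<Sum>x\<in>S. a x) \<le> \<bar>\<Sum>x\<in>S. \<mu> x\<bar> powr p\<close>, where \<open>\<mu> x\<close> is the mass sent from \<open>v\<close> to \<open>x\<close>
  and \<open>a x\<close> is the unit vector towards \<open>x\<close> scaled by \<open>\<bar>\<mu> x\<bar> powr p\<close>; for the set of all branches the
  \<open>a x\<close> therefore sum to zero. The pairs bound the Gram matrix of the \<open>a x\<close> from above. For \<open>p < 1/2\<close> and
  at least four branches the row of a branch of maximal mass would then have a negative sum.

  In the plane the pairs bound the angles between neighbouring branches from below. Since
  \<open>\<bar>x - y\<bar> powr (2 * p)\<close> is strictly of negative type, the real line with the metric \<open>\<bar>x - y\<bar> powr p\<close>
  embeds in a Hilbert space with affinely independent images of distinct points. The lower bounds are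
  the exterior angles of the closed polygon through the images of the partial sums of the masses, taken
  in cyclic order, so for at least four branches they add up to more than \<open>2 * pi\<close> by Fenchel's theorem.

  For \<open>p \<ge> 1/2\<close> take \<open>d\<close> unit vectors in \<open>d\<close>-space with equal inner products whose sum has norm
  \<open>d powr p\<close>. Concavity of \<open>s powr (2 * p - 1)\<close> shows that they calibrate: the combination with weights
  \<open>\<theta> i\<close> in the unit interval has norm at most \<open>(\<Sum>i. \<theta> i) powr p\<close>. A flow from \<open>d\<close> unit sources to one
  sink can be decomposed into \<open>d\<close> commodities, each of mass at most one on every arc once circulations
  are removed, so the calibration bounds its cost from below by the cost of the star.
\<close>

section \<open>Local optimality at a branching point\<close>

definition edge_val :: "('a \<Rightarrow> 'a \<Rightarrow> 'b) \<Rightarrow> 'a set \<Rightarrow> 'b" where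
  "edge_val F e = (case edge_pair e of (x, y) \<Rightarrow> F x y)"

text \<open>The pair picked by \<open>edge_pair\<close> is one of the two orientations of the edge,
  so symmetry of \<open>F\<close> at its endpoints makes the value well defined.\<close>

lemma edge_val_doubleton:
  assumes "F x y = F y x"
  shows "edge_val F {x, y} = F x y"
proof -
  have "{x, y} = {fst (edge_pair {x, y}), snd (edge_pair {x, y})}"
    unfolding edge_pair_def by (rule someI[of _ "(x, y)"]) simp
  then show ?thesis
    using assms by (auto simp: edge_val_def split_beta doubleton_eq_iff)
qed

text \<open>Contribution of one oriented edge to the divergence at \<open>z\<close>. For
  antisymmetric \<open>m\<close> both factors change sign when the endpoints are swapped, so the
  product descends to unordered edges.\<close>

definition unit_div :: "('a \<Rightarrow> 'a \<Rightarrow> real) \<Rightarrow> 'a \<Rightarrow> 'a \<Rightarrow> 'a \<Rightarrow> real" where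
  "unit_div m z x y = m x y * ((if z = y then 1 else 0) - (if z = x then 1 else 0))"

lemma flow_div_alt: "flow_div E m z = (\<Sum>e\<in>E. edge_val (unit_div m z) e)"
  by (simp add: flow_div_def edge_val_def unit_div_def)

definition edge_cost :: "real \<Rightarrow> ('a::metric_space \<Rightarrow> 'a \<Rightarrow> real) \<Rightarrow> 'a \<Rightarrow> 'a \<Rightarrow> real" where
  "edge_cost p m x y = \<bar>m x y\<bar> powr p * dist x y"

lemma gilbert_alt: "gilbert p E m = (\<Sum>e\<in>E. edge_val (edge_cost p m) e)"
  by (simp add: gilbert_def edge_val_def edge_cost_def)

lemma edge_val_unit_div:
  assumes "m x y = - m y x" shows "edge_val (unit_div m z) {x, y} = unit_div m z x y"
  using assms by (intro edge_val_doubleton) (auto simp: unit_div_def algebra_simps)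

lemma edge_val_edge_cost:
  assumes "m x y = - m y x" shows "edge_val (edge_cost p m) {x, y} = edge_cost p m x y"
  using assms by (intro edge_val_doubleton) (auto simp: edge_cost_def dist_commute)

lemma is_flowD:
  assumes "is_flow mp mm V E m"
  shows "finite V" "finite E" "\<And>e. e \<in> E \<Longrightarrow> e \<subseteq> V \<and> card e = 2"
    "\<And>x y. {x, y} \<in> E \<Longrightarrow> m x y \<noteq> 0" "\<And>x y. {x, y} \<in> E \<Longrightarrow> m x y = - m y x"
    "\<And>z. mp z - mm z = flow_div E m z" "{x. mp x - mm x \<noteq> 0} \<subseteq> V"
  using assms unfolding is_flow_def by (elim conjE; blast)+

lemma is_flow_edgeE:
  assumes "is_flow mp mm V E m" "e \<in> E"
  obtains x y where "e = {x, y}" "x \<noteq> y" "x \<in> V" "y \<in> V"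
  using is_flowD(3)[OF assms] by (auto simp: card_2_iff)

section \<open>The star of a vertex and its mass balance\<close>

definition nbrs :: "'a set set \<Rightarrow> 'a \<Rightarrow> 'a set" where
  "nbrs E v = {x. {v, x} \<in> E}"

lemma nbrs_props:
  assumes "is_flow mp mm V E m"
  shows "finite (nbrs E v)" "v \<notin> nbrs E v" "nbrs E v \<subseteq> V"
    "{e \<in> E. v \<in> e} = (\<lambda>x. {v, x}) ` nbrs E v" "degree E v = card (nbrs E v)"
proof -
  show sub: "nbrs E v \<subseteq> V" using is_flowD(3)[OF assms] by (fastforce simp: nbrs_def)
  then show "finite (nbrs E v)" using is_flowD(1)[OF assms] by (rule finite_subset)
  show "v \<notin> nbrs E v" using is_flowD(3)[OF assms, of "{v}"] by (auto simp: nbrs_def)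
  show eq: "{e \<in> E. v \<in> e} = (\<lambda>x. {v, x}) ` nbrs E v"
  proof (intro equalityI subsetI)
    fix e assume e: "e \<in> {e \<in> E. v \<in> e}"
    then obtain x y where "e = {x, y}" using is_flow_edgeE[OF assms, of e] by blast
    with e have "e = {v, x} \<or> e = {v, y}" by auto
    with e show "e \<in> (\<lambda>x. {v, x}) ` nbrs E v" by (auto simp: nbrs_def)
  qed (auto simp: nbrs_def)
  have "inj_on (\<lambda>x. {v, x}) (nbrs E v)" by (auto simp: inj_on_def doubleton_eq_iff)
  then show "degree E v = card (nbrs E v)" by (simp add: degree_def eq card_image)
qed

text \<open>Kirchhoff's law: only the edges at \<open>v\<close> contribute to the divergence at
  \<open>v\<close>, each with minus the mass that it carries away.\<close>

lemma nbrs_sum: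
  assumes fl: "is_flow mp mm V E m" and v: "mp v = mm v"
  shows "(\<Sum>x\<in>nbrs E v. m v x) = 0"
proof -
  have inj: "inj_on (\<lambda>x. {v, x}) (nbrs E v)" by (auto simp: inj_on_def doubleton_eq_iff)
  have "0 = (\<Sum>e\<in>E. edge_val (unit_div m v) e)"
    using is_flowD(6)[OF fl, of v] v by (simp add: flow_div_alt)
  also have "\<dots> = (\<Sum>e\<in>{e \<in> E. v \<in> e}. edge_val (unit_div m v) e)"
  proof (rule sum.mono_neutral_right)
    show "\<forall>e\<in>E - {e \<in> E. v \<in> e}. edge_val (unit_div m v) e = 0"
    proof
      fix e assume e: "e \<in> E - {e \<in> E. v \<in> e}"
      then obtain x y where xy: "e = {x, y}" using is_flow_edgeE[OF fl, of e] by blast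
      then have "m x y = - m y x" using e is_flowD(5)[OF fl] by auto
      then show "edge_val (unit_div m v) e = 0" using e xy by (auto simp: edge_val_unit_div unit_div_def)
    qed
  qed (auto simp: is_flowD[OF fl])
  also have "\<dots> = (\<Sum>x\<in>nbrs E v. edge_val (unit_div m v) {v, x})"
    by (simp add: nbrs_props(4)[OF fl] sum.reindex[OF inj])
  also have "\<dots> = (\<Sum>x\<in>nbrs E v. - m v x)"
  proof (rule sum.cong)
    fix x assume x: "x \<in> nbrs E v"
    then have "m v x = - m x v" using is_flowD(5)[OF fl, of v x] by (simp add: nbrs_def)
    moreover have "x \<noteq> v" using x nbrs_props(2)[OF fl] by auto
    ultimately show "edge_val (unit_div m v) {v, x} = - m v x"
      by (simp add: edge_val_unit_div unit_div_def)
  qed simp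
  finally show ?thesis by (simp add: sum_negf)
qed

text \<open>The branches in \<open>S\<close> are detached from \<open>v\<close>, attached to the new vertex \<open>v'\<close>, and \<open>v'\<close> is fed from
  \<open>v\<close> by an edge that carries the total mass of \<open>S\<close>.\<close>

lemma minimal_flow_split:
  fixes mp mm :: "'a::metric_space \<Rightarrow> real"
  assumes mf: "minimal_flow p mp mm V E m" and S: "S \<subseteq> nbrs E v" and v: "v \<in> V" and v': "v' \<notin> V"
  shows "(\<Sum>x\<in>S. \<bar>m v x\<bar> powr p * dist v x)
    \<le> (\<Sum>x\<in>S. \<bar>m v x\<bar> powr p * dist v' x) + \<bar>\<Sum>x\<in>S. m v x\<bar> powr p * dist v v'"
proof -
  have fl: "is_flow mp mm V E m" using mf by (simp add: minimal_flow_def)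
  note f = is_flowD[OF fl] and nb = nbrs_props[OF fl, of v]
  define \<mu> where "\<mu> = (\<Sum>x\<in>S. m v x)"
  define E1 where "E1 = (\<lambda>x. {v, x}) ` S"
  define E2 where "E2 = (\<lambda>x. {v', x}) ` S"
  \<comment> \<open>Edges must carry non-zero mass, so the feeding edge is omitted when the detached
    masses cancel. Its cost term then vanishes anyway, as \<open>0 powr p = 0\<close>.\<close>
  define E3 where "E3 = (if \<mu> = 0 then {} else {{v, v'}})"
  define E' where "E' = (E - E1) \<union> (E2 \<union> E3)"
  define m' where "m' = (\<lambda>x y. if x = v' then (if y = v then - \<mu> else m v y)
     else if y = v' then (if x = v then \<mu> else m x v) else m x y)"
  have finS: "finite S" and vS: "v \<notin> S" and SV: "S \<subseteq> V"
    using S nb finite_subset[OF S] by blast+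
  have v'S: "v' \<notin> S" "v \<noteq> v'" using SV v v' by auto
  have E1E: "E1 \<subseteq> E" using S by (auto simp: E1_def nbrs_def)
  have ED: "e \<subseteq> V" if "e \<in> E" for e using that f(3) by blast
  have anti: "m v x = - m x v" "m v x \<noteq> 0" if "x \<in> S" for x
    using that S f(4,5)[of v x] by (auto simp: nbrs_def)
  have inj: "inj_on (\<lambda>x. {v, x}) S" "inj_on (\<lambda>x. {v', x}) S"
    by (auto simp: inj_on_def doubleton_eq_iff)
  have "v' \<in> e" if "e \<in> E2 \<union> E3" for e using that by (auto simp: E2_def E3_def split: if_splits)
  then have dj: "(E - E1) \<inter> (E2 \<union> E3) = {}" using ED v' by blast
  have dj2: "E2 \<inter> E3 = {}" using v'S vS by (auto simp: E2_def E3_def doubleton_eq_iff)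
  have fin: "finite (E - E1)" "finite E2" "finite E3" "finite E1"
    using f(2) finS by (auto simp: E1_def E2_def E3_def)
  \<comment> \<open>Divergence and cost are both edge sums of orientation-independent quantities.
    This identity serves both, with \<open>G k\<close> equal to \<open>unit_div k z\<close> or
    \<open>edge_cost p k\<close>.\<close>
  have sums: "(\<Sum>e\<in>E'. edge_val (G m') e) = (\<Sum>e\<in>E. edge_val (G m) e) - (\<Sum>x\<in>S. G m v x)
      + ((\<Sum>x\<in>S. G m' v' x) + (if \<mu> = 0 then 0 else G m' v v'))"
    if G: "\<And>k x y. (k x y :: real) = - k y x \<Longrightarrow> edge_val (G k) {x, y} = G k x y"
      and G2: "\<And>x y. x \<in> V \<Longrightarrow> y \<in> V \<Longrightarrow> G m' x y = G m x y" for G :: "_ \<Rightarrow> _ \<Rightarrow> _ \<Rightarrow> real"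
  proof -
    have 1: "edge_val (G m') e = edge_val (G m) e" if e: "e \<in> E" for e
    proof -
      obtain x y where xy: "e = {x, y}" "x \<in> V" "y \<in> V" using is_flow_edgeE[OF fl e] by metis
      have "m x y = - m y x" using f(5) e xy by auto
      moreover have "m' x y = m x y" "m' y x = m y x" using xy v' by (auto simp: m'_def)
      ultimately show ?thesis using G[of m' x y] G[of m x y] G2 xy by auto
    qed
    have 2: "edge_val (G m') {v', x} = G m' v' x" if "x \<in> S" for x
      using that anti[OF that] v'S vS by (intro G) (auto simp: m'_def)
    have 3: "edge_val (G m') {v, v'} = G m' v v'" using v'S by (intro G) (auto simp: m'_def)
    have 4: "edge_val (G m) {v, x} = G m v x" if "x \<in> S" for x by (rule G[of m v x, OF anti(1)[OF that]])
    have "(\<Sum>e\<in>E'. edge_val (G m') e) = (\<Sum>e\<in>E-E1. edge_val (G m') e) + ((\<Sum>e\<in>E2. edge_val (G m') e) + (\<Sum>e\<in>E3. edge_val (G m') e))"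
      unfolding E'_def using fin dj dj2 by (simp add: sum.union_disjoint)
    also have "(\<Sum>e\<in>E-E1. edge_val (G m') e) = (\<Sum>e\<in>E-E1. edge_val (G m) e)"
      using 1 by (intro sum.cong) auto
    also have "\<dots> = (\<Sum>e\<in>E. edge_val (G m) e) - (\<Sum>e\<in>E1. edge_val (G m) e)"
      using f(2) E1E by (simp add: sum_diff)
    also have "(\<Sum>e\<in>E1. edge_val (G m) e) = (\<Sum>x\<in>S. G m v x)"
      unfolding E1_def using inj 4 by (simp add: sum.reindex)
    also have "(\<Sum>e\<in>E2. edge_val (G m') e) = (\<Sum>x\<in>S. G m' v' x)"
      unfolding E2_def using inj 2 by (simp add: sum.reindex)
    also have "(\<Sum>e\<in>E3. edge_val (G m') e) = (if \<mu> = 0 then 0 else G m' v v')"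
      using 3 by (simp add: E3_def)
    finally show ?thesis .
  qed
  have "is_flow mp mm (insert v' V) E' m'"
    unfolding is_flow_def
  proof (intro conjI ballI allI impI)
    show "finite (insert v' V)" "{x. mp x - mm x \<noteq> 0} \<subseteq> insert v' V" "finite E'"
      using f fin by (auto simp: E'_def)
    fix e assume "e \<in> E'"
    then show "e \<subseteq> insert v' V" "card e = 2"
      using f(3) SV v v'S by (auto simp: E'_def E2_def E3_def card_2_iff split: if_splits)
  next
    fix x y assume xy: "{x, y} \<in> E'"
    have "m' x y \<noteq> 0 \<and> m' x y = - m' y x"
    proof -
      consider "{x, y} \<in> E" | s where "s \<in> S" "{x, y} = {v', s}" | "\<mu> \<noteq> 0" "{x, y} = {v, v'}"
        using xy by (auto simp: E'_def E2_def E3_def split: if_splits)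
      then show ?thesis
      proof cases
        case 1
        then have "x \<noteq> v'" "y \<noteq> v'" using ED v' by auto
        then show ?thesis using 1 f(4,5)[of x y] by (auto simp: m'_def)
      next
        case 2
        then show ?thesis using anti[of s] v'S vS by (auto simp: m'_def doubleton_eq_iff)
      next
        case 3
        then show ?thesis using v'S by (auto simp: m'_def doubleton_eq_iff)
      qed
    qed
    then show "m' x y \<noteq> 0" "m' x y = - m' y x" by auto
  next
    fix z
    have "(\<Sum>e\<in>E'. edge_val (unit_div m' z) e) = (\<Sum>e\<in>E. edge_val (unit_div m z) e) - (\<Sum>x\<in>S. unit_div m z v x)
      + ((\<Sum>x\<in>S. unit_div m' z v' x) + (if \<mu> = 0 then 0 else unit_div m' z v v'))"
      using v' by (intro sums[of "\<lambda>k. unit_div k z"] edge_val_unit_div) (auto simp: unit_div_def m'_def)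
    also have "(if \<mu> = 0 then 0 else unit_div m' z v v') = \<mu> * ((if z = v' then 1 else 0) - (if z = v then 1 else 0))"
      using v'S by (auto simp: unit_div_def m'_def)
    also have "(\<Sum>x\<in>S. unit_div m' z v' x) = (\<Sum>x\<in>S. unit_div m z v x) + \<mu> * ((if z = v then 1 else 0) - (if z = v' then 1 else 0))"
    proof -
      have "unit_div m' z v' x = unit_div m z v x + m v x * ((if z = v then 1 else 0) - (if z = v' then 1 else 0))"
        if "x \<in> S" for x using that vS v'S by (auto simp: unit_div_def m'_def algebra_simps)
      then show ?thesis by (simp add: sum.distrib \<mu>_def sum_distrib_right)
    qed
    finally show "mp z - mm z = flow_div E' m' z"
      using f(6) by (simp add: flow_div_alt algebra_simps)
  qed
  then have "gilbert p E m \<le> gilbert p E' m'" using mf by (simp add: minimal_flow_def)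
  moreover have "gilbert p E' m' = gilbert p E m - (\<Sum>x\<in>S. edge_cost p m v x)
      + ((\<Sum>x\<in>S. edge_cost p m' v' x) + (if \<mu> = 0 then 0 else edge_cost p m' v v'))"
    unfolding gilbert_alt using v'
    by (intro sums[of "edge_cost p"] edge_val_edge_cost) (auto simp: edge_cost_def m'_def)
  moreover have "(\<Sum>x\<in>S. edge_cost p m' v' x) = (\<Sum>x\<in>S. \<bar>m v x\<bar> powr p * dist v' x)"
    using vS by (intro sum.cong) (auto simp: edge_cost_def m'_def)
  moreover have "(if \<mu> = 0 then 0 else edge_cost p m' v v') = \<bar>\<mu>\<bar> powr p * dist v v'"
    using v'S by (auto simp: edge_cost_def m'_def)
  ultimately show ?thesis by (simp add: \<mu>_def edge_cost_def)
qed

text \<open>First variation of the split: moving the new vertex away from \<open>v\<close> along the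
  resultant \<open>A\<close> changes the cost at the rate
  \<open>- (A \<bullet> A) + \<mu> * norm A\<close>, which cannot be negative at a minimum.\<close>

lemma minimal_flow_calibrated:
  fixes mp mm :: "'a::euclidean_space \<Rightarrow> real"
  assumes mf: "minimal_flow p mp mm V E m" and S: "S \<subseteq> nbrs E v" and v: "v \<in> V"
  shows "norm (\<Sum>x\<in>S. \<bar>m v x\<bar> powr p *\<^sub>R sgn (x - v)) \<le> \<bar>\<Sum>x\<in>S. m v x\<bar> powr p"
proof -
  have fl: "is_flow mp mm V E m" using mf by (simp add: minimal_flow_def)
  have finS: "finite S" and vS: "v \<notin> S"
    using S nbrs_props[OF fl, of v] finite_subset[OF S] by blast+
  define A where "A = (\<Sum>x\<in>S. \<bar>m v x\<bar> powr p *\<^sub>R sgn (x - v))"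
  define \<mu> where "\<mu> = \<bar>\<Sum>x\<in>S. m v x\<bar> powr p"
  \<comment> \<open>For \<open>t \<ge> 0\<close> these are the terms of the cost that depend on the
    new vertex \<open>v + t *\<^sub>R A\<close>. The feeding edge enters through \<open>t\<close>
    rather than \<open>\<bar>t\<bar>\<close>, which makes \<open>\<phi>\<close> differentiable at
    0.\<close>
  define \<phi> where "\<phi> = (\<lambda>t::real. (\<Sum>x\<in>S. \<bar>m v x\<bar> powr p * dist (v + t *\<^sub>R A) x) + \<mu> * norm A * t)"
  have "norm A \<le> \<mu>" if A: "A \<noteq> 0"
  proof -
    have d: "(\<phi> has_real_derivative (- (A \<bullet> A) + \<mu> * norm A)) (at 0)"
    proof -
      have "((\<lambda>t. \<bar>m v x\<bar> powr p * dist (v + t *\<^sub>R A) x) has_real_derivative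
          \<bar>m v x\<bar> powr p * - (A \<bullet> sgn (x - v))) (at 0)" if x: "x \<in> S" for x
      proof -
        have ne: "v - x \<noteq> 0" using x vS by auto
        have "((\<lambda>t. norm ((v - x) + t *\<^sub>R A)) has_derivative (\<lambda>t. (t *\<^sub>R A) \<bullet> sgn (v - x))) (at (0::real))"
          by (rule has_derivative_compose[of _ "\<lambda>t. t *\<^sub>R A" _ _ norm "\<lambda>y. y \<bullet> sgn (v - x)", THEN has_derivative_eq_rhs])
            (use ne in \<open>auto intro!: derivative_eq_intros has_derivative_norm\<close>)
        then have "((\<lambda>t. norm ((v - x) + t *\<^sub>R A)) has_real_derivative - (A \<bullet> sgn (x - v))) (at 0)"
          unfolding has_field_derivative_def
          by (rule has_derivative_eq_rhs) (auto simp: fun_eq_iff sgn_div_norm norm_minus_commute[of v x] inner_diff_right algebra_simps)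
        then show ?thesis
          by (intro DERIV_cmult) (simp add: dist_norm algebra_simps)
      qed
      then have "((\<lambda>t. \<Sum>x\<in>S. \<bar>m v x\<bar> powr p * dist (v + t *\<^sub>R A) x) has_real_derivative
          (\<Sum>x\<in>S. \<bar>m v x\<bar> powr p * - (A \<bullet> sgn (x - v)))) (at 0)"
        by (intro DERIV_sum) auto
      moreover have "(\<Sum>x\<in>S. \<bar>m v x\<bar> powr p * - (A \<bullet> sgn (x - v))) = - (A \<bullet> A)"
        by (subst (3) A_def) (simp add: inner_sum_right sum_negf)
      ultimately have "((\<lambda>t. \<Sum>x\<in>S. \<bar>m v x\<bar> powr p * dist (v + t *\<^sub>R A) x) has_real_derivative - (A \<bullet> A)) (at 0)"
        by simp
      moreover have "((\<lambda>t. \<mu> * norm A * t) has_real_derivative \<mu> * norm A) (at 0)"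
        by (auto intro!: derivative_eq_intros)
      ultimately show ?thesis unfolding \<phi>_def by (rule DERIV_add)
    qed
    show ?thesis
    proof (rule ccontr)
      assume "\<not> norm A \<le> \<mu>"
      then have "- (A \<bullet> A) + \<mu> * norm A < 0"
        using A by (simp add: dot_square_norm power2_eq_square)
      then obtain \<delta> where \<delta>: "\<delta> > 0" "\<And>h. 0 < h \<Longrightarrow> h < \<delta> \<Longrightarrow> \<phi> (0 + h) < \<phi> 0"
        using DERIV_neg_dec_right[OF d] by blast
      \<comment> \<open>The split needs a point outside \<open>V\<close>; only finitely many
        parameters hit \<open>V\<close>, so some small positive \<open>h\<close> avoids it.\<close>
      have "finite ((\<lambda>t. v + t *\<^sub>R A) -` V)"
        by (rule finite_vimageI) (use is_flowD(1)[OF fl] A in \<open>auto simp: inj_def\<close>)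
      moreover have "infinite {0<..<\<delta>}" using \<delta> by simp
      ultimately have "\<not> {0<..<\<delta>} \<subseteq> (\<lambda>t. v + t *\<^sub>R A) -` V" using finite_subset by blast
      then obtain h where h: "h \<in> {0<..<\<delta>}" "v + h *\<^sub>R A \<notin> V" by blast
      have "\<phi> 0 \<le> \<phi> h"
        using minimal_flow_split[OF mf S v h(2)] h(1) by (simp add: \<phi>_def \<mu>_def dist_norm algebra_simps)
      with \<delta>(2)[of h] h(1) show False by simp
    qed
  qed
  then show ?thesis unfolding A_def[symmetric] \<mu>_def[symmetric] by (cases "A = 0") (auto simp: \<mu>_def)
qed

section \<open>Exponents below one half\<close>

lemma DERIV_shift_powr:
  fixes t c r :: real
  assumes "0 < t + c"
  shows "((\<lambda>t. (t + c) powr r) has_real_derivative r * (t + c) powr (r - 1)) (at t)"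
  using assms by (auto intro!: derivative_eq_intros)

text \<open>The gap between the two sides is \<open>\<phi> c - \<phi> 0\<close>. The derivative of
  \<open>\<phi>\<close> is \<open>q\<close> times a second difference of
  \<open>t powr (q - 1)\<close>, which is strictly convex.\<close>

lemma powr_sub_third_difference:
  fixes a b c q :: real
  assumes "0 < q" "q < 1" "0 < a" "0 < b" "0 < c"
  shows "(c + a) powr q + (c + b) powr q + (a + b) powr q
     < (a + b + c) powr q + a powr q + b powr q + c powr q"
proof -
  define \<phi> where "\<phi> = (\<lambda>t. (t + (a + b)) powr q - (t + a) powr q - (t + b) powr q + t powr q)"
  have strict: "(t + a) powr (q - 1) + (t + b) powr (q - 1) < (t + (a + b)) powr (q - 1) + t powr (q - 1)" if "t > 0" for t
  proof -
    define \<psi> where "\<psi> = (\<lambda>s. (s + (t + a)) powr (q - 1) - (s + t) powr (q - 1))"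
    have D: "\<exists>y. (\<psi> has_real_derivative y) (at s) \<and> 0 < y" if s: "0 \<le> s" "s \<le> b" for s
    proof (intro exI conjI)
      show "(\<psi> has_real_derivative (q - 1) * (s + (t + a)) powr (q - 1 - 1) - (q - 1) * (s + t) powr (q - 1 - 1)) (at s)"
        unfolding \<psi>_def using s \<open>t > 0\<close> assms by (intro DERIV_diff DERIV_shift_powr) auto
      have "(s + (t + a)) powr (q - 1 - 1) < (s + t) powr (q - 1 - 1)"
        using s \<open>t > 0\<close> assms by (intro powr_less_mono2_neg) auto
      then have "(q - 1) * (s + t) powr (q - 1 - 1) < (q - 1) * (s + (t + a)) powr (q - 1 - 1)"
        using assms by (intro mult_strict_left_mono_neg) auto
      then show "0 < (q - 1) * (s + (t + a)) powr (q - 1 - 1) - (q - 1) * (s + t) powr (q - 1 - 1)" by simp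
    qed
    have "\<psi> 0 < \<psi> b" by (rule DERIV_pos_imp_increasing[OF \<open>0 < b\<close>]) (rule D)
    moreover have "b + (t + a) = t + (a + b)" "b + t = t + b" by simp_all
    ultimately show ?thesis unfolding \<psi>_def by simp
  qed
  have "\<phi> 0 < \<phi> c"
  \<comment> \<open>\<open>t powr q\<close> has no finite derivative at 0, hence the version that
    asks for derivatives inside the interval and continuity up to its ends.\<close>
  proof (rule DERIV_pos_imp_increasing_open[OF \<open>0 < c\<close>])
    fix t assume t: "0 < t" "t < c"
    show "\<exists>y. (\<phi> has_real_derivative y) (at t) \<and> 0 < y"
    proof (intro exI conjI)
      show "(\<phi> has_real_derivative q * (t + (a + b)) powr (q - 1) - q * (t + a) powr (q - 1) - q * (t + b) powr (q - 1) + q * t powr (q - 1)) (at t)"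
        unfolding \<phi>_def using t assms DERIV_shift_powr[of t 0 q]
        by (intro DERIV_diff DERIV_add DERIV_shift_powr) auto
      have "0 < q * ((t + (a + b)) powr (q - 1) + t powr (q - 1) - ((t + a) powr (q - 1) + (t + b) powr (q - 1)))"
        using strict[OF t(1)] assms by simp
      then show "0 < q * (t + (a + b)) powr (q - 1) - q * (t + a) powr (q - 1) - q * (t + b) powr (q - 1) + q * t powr (q - 1)"
        by (simp only: ring_distribs)
    qed
  next
    show "continuous_on {0..c} \<phi>" unfolding \<phi>_def using assms
      by (intro continuous_on_add continuous_on_diff continuous_on_powr' continuous_on_id continuous_on_const) auto
  qed
  moreover have "c + (a + b) = a + b + c" by simp
  ultimately show ?thesis unfolding \<phi>_def by simp
qed

text \<open>In \<open>x powr q = x * x powr (q - 1)\<close> the second factor is strictly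
  decreasing.\<close>

lemma powr_strict_subadditive:
  fixes a b q :: real
  assumes "0 < q" "q < 1" "0 < a" "0 < b"
  shows "(a + b) powr q < a powr q + b powr q"
proof -
  have "(a + b) powr q = (a + b) * (a + b) powr (q - 1)" using assms by (simp add: powr_mult_base)
  also have "\<dots> = a * (a + b) powr (q - 1) + b * (a + b) powr (q - 1)" by (simp add: algebra_simps)
  also have "\<dots> < a * a powr (q - 1) + b * b powr (q - 1)"
    using assms by (intro add_strict_mono mult_strict_left_mono powr_less_mono2_neg) auto
  also have "\<dots> = a powr q + b powr q" using assms by (simp add: powr_mult_base)
  finally show ?thesis .
qed

text \<open>The bound that a pair of branches with masses \<open>M > 0\<close> and \<open>- y\<close> puts on minus twice
  the inner product of its calibrating vectors.\<close>

definition pair_bound :: "real \<Rightarrow> real \<Rightarrow> real \<Rightarrow> real" where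
  "pair_bound q M y = M powr q + \<bar>y\<bar> powr q - \<bar>M - y\<bar> powr q"

context
  fixes q M :: real
  assumes q: "0 < q" "q < 1" and M: "0 < M"
begin

lemma pair_bound_mono: "0 \<le> y \<Longrightarrow> y \<le> z \<Longrightarrow> z \<le> M \<Longrightarrow> pair_bound q M y \<le> pair_bound q M z"
  using q by (auto simp: pair_bound_def intro!: add_mono diff_mono powr_mono2)

lemma pair_bound_neg: "y < 0 \<Longrightarrow> 0 < pair_bound q M y"
  using powr_strict_subadditive[OF q, of M "- y"] M by (simp add: pair_bound_def)

text \<open>The gap is the third difference of \<open>t powr q\<close> with increments
  \<open>y\<close>, \<open>z\<close> and \<open>M - y - z\<close>. At \<open>y + z = M\<close> both
  sides agree, so strictness requires a positive remainder.\<close>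

lemma pair_bound_add_less:
  assumes "0 < y" "0 < z" "y + z < M"
  shows "pair_bound q M (y + z) < pair_bound q M y + pair_bound q M z"
  using powr_sub_third_difference[OF q, of y z "M - y - z"] assms
  by (simp add: pair_bound_def add.commute diff_diff_eq)

lemma pair_bound_add:
  assumes "0 < y" "0 < z" "y + z \<le> M"
  shows "pair_bound q M (y + z) \<le> pair_bound q M y + pair_bound q M z"
proof (cases "y + z < M")
  case False
  then have "M = y + z" using assms by simp
  then show ?thesis using assms by (simp add: pair_bound_def)
qed (use pair_bound_add_less[of y z] assms in simp)

lemma pair_bound_sum:
  assumes "finite P" "P \<noteq> {}" "\<And>j. j \<in> P \<Longrightarrow> 0 < y j" "sum y P \<le> M"
  shows "pair_bound q M (sum y P) \<le> (\<Sum>j\<in>P. pair_bound q M (y j))"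
  using assms
proof (induction P rule: finite_ne_induct)
  case (insert j P)
  have pos: "0 < sum y P" using insert by (intro sum_pos) auto
  have "0 < y j" using insert by simp
  then have "sum y P \<le> M" using insert.hyps insert.prems(2) by simp
  then have "pair_bound q M (sum y P) \<le> (\<Sum>j\<in>P. pair_bound q M (y j))" using insert by auto
  then show ?case using insert pair_bound_add[of "y j" "sum y P"] pos by simp
qed simp

lemma pair_bound_top: "pair_bound q M M = 2 * M powr q"
  using M by (simp add: pair_bound_def)

text \<open>Scaling the masses down to total \<open>M\<close> can only lower the bounds;
  subadditivity then merges them into \<open>pair_bound q M M\<close>.\<close>

lemma pair_bound_sum_top:
  assumes P: "finite P" and pos: "\<And>j. j \<in> P \<Longrightarrow> 0 < y j" and le: "\<And>j. j \<in> P \<Longrightarrow> y j \<le> M" and ge: "M \<le> sum y P"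
  shows "2 * M powr q \<le> (\<Sum>j\<in>P. pair_bound q M (y j))"
    and "3 \<le> card P \<Longrightarrow> 2 * M powr q < (\<Sum>j\<in>P. pair_bound q M (y j))"
proof -
  have ne: "P \<noteq> {}" using ge M by auto
  define s where "s = sum y P"
  define z where "z = (\<lambda>j. y j * (M / s))"
  have s: "s > 0" "M \<le> s" using ge M by (auto simp: s_def)
  have z: "0 < z j" "z j \<le> y j" "z j \<le> M" if "j \<in> P" for j
  proof -
    show "0 < z j" using pos[OF that] s M by (simp add: z_def)
    have "y j * (M / s) \<le> y j * 1" using pos[OF that] s M by (intro mult_left_mono) auto
    then show "z j \<le> y j" by (simp add: z_def)
    then show "z j \<le> M" using le[OF that] by simp
  qed
  have sz: "sum z P = M" using s by (simp add: z_def sum_distrib_right[symmetric] s_def[symmetric] sum_divide_distrib[symmetric])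
  have mono: "(\<Sum>j\<in>P. pair_bound q M (z j)) \<le> (\<Sum>j\<in>P. pair_bound q M (y j))"
    using z le by (intro sum_mono pair_bound_mono) (auto intro: less_imp_le)
  have "2 * M powr q \<le> (\<Sum>j\<in>P. pair_bound q M (z j))"
    using pair_bound_sum[OF P ne, of z] z sz by (simp add: pair_bound_top)
  with mono show "2 * M powr q \<le> (\<Sum>j\<in>P. pair_bound q M (y j))" by simp
  assume "3 \<le> card P"
  \<comment> \<open>With three parts, \<open>j\<close> and \<open>Q\<close> merge to a total below
    \<open>M\<close> because \<open>z i\<close> is positive, so this merge is strict.\<close>
  then obtain i R where R: "P = insert i R" "i \<notin> R" "2 \<le> card R" "finite R"
    using P by (metis One_nat_def card_le_Suc_iff finite_insert numeral_2_eq_2 numeral_3_eq_3)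
  obtain j Q where Q: "R = insert j Q" "j \<notin> Q" "1 \<le> card Q" "finite Q"
    using R(3,4) by (metis One_nat_def card_le_Suc_iff finite_insert numeral_2_eq_2)
  have Qne: "Q \<noteq> {}" using Q by auto
  have PQ: "i \<in> P" "j \<in> P" "Q \<subseteq> P" "i \<noteq> j" "i \<notin> Q" using R Q by auto
  have Qpos: "0 < sum z Q" using Qne Q PQ z by (intro sum_pos) auto
  have tot: "z i + (z j + sum z Q) = M" using sz R Q PQ by simp
  have "2 * M powr q = pair_bound q M (z i + (z j + sum z Q))" by (simp add: tot pair_bound_top)
  also have "\<dots> \<le> pair_bound q M (z i) + pair_bound q M (z j + sum z Q)"
    using tot Qpos z[OF PQ(1)] z[OF PQ(2)] by (intro pair_bound_add) auto
  also have "pair_bound q M (z j + sum z Q) < pair_bound q M (z j) + pair_bound q M (sum z Q)"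
    using tot Qpos z(1)[OF PQ(1)] z(1)[OF PQ(2)] by (intro pair_bound_add_less) auto
  also have "pair_bound q M (sum z Q) \<le> (\<Sum>j\<in>Q. pair_bound q M (z j))"
    using pair_bound_sum[of Q z] Qne Q PQ z tot z(1)[OF PQ(1)] z(1)[OF PQ(2)] by auto
  also have "pair_bound q M (z i) + (pair_bound q M (z j) + (\<Sum>j\<in>Q. pair_bound q M (z j))) = (\<Sum>j\<in>P. pair_bound q M (z j))"
    using R Q PQ by simp
  finally show "2 * M powr q < (\<Sum>j\<in>P. pair_bound q M (y j))" using mono by simp
qed

text \<open>The positive masses alone already reach \<open>M\<close>. Strictness comes from a
  negative mass, whose bound is positive, or else from having at least three positive ones.\<close>

lemma pair_bound_star:
  assumes J: "finite J" "3 \<le> card J" and ne: "\<And>j. j \<in> J \<Longrightarrow> y j \<noteq> 0"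
    and le: "\<And>j. j \<in> J \<Longrightarrow> y j \<le> M" and sum: "sum y J = M"
  shows "2 * M powr q < (\<Sum>j\<in>J. pair_bound q M (y j))"
proof -
  define P where "P = {j \<in> J. 0 < y j}"
  define N where "N = {j \<in> J. y j < 0}"
  have JPN: "J = P \<union> N" "P \<inter> N = {}" "finite P" "finite N" using ne J by (auto simp: P_def N_def neq_iff)
  have split: "sum g J = sum g P + sum g N" for g :: "_ \<Rightarrow> real"
    unfolding JPN(1) using JPN by (intro sum.union_disjoint) auto
  have "sum y N \<le> 0" by (intro sum_nonpos) (auto simp: N_def)
  then have "M \<le> sum y P" using split[of y] sum by simp
  note top = pair_bound_sum_top[of P y, OF JPN(3) _ _ this]
  have PM: "0 < y j" "y j \<le> M" if "j \<in> P" for j using that le by (auto simp: P_def)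
  have Nnn: "0 \<le> (\<Sum>j\<in>N. pair_bound q M (y j))"
    by (intro sum_nonneg less_imp_le pair_bound_neg) (auto simp: N_def)
  show ?thesis
  proof (cases "N = {}")
    case True
    then have "J = P" using JPN by simp
    then show ?thesis using top(2) PM J by simp
  next
    case False
    then have "0 < (\<Sum>j\<in>N. pair_bound q M (y j))"
      by (intro sum_pos[OF JPN(4)]) (auto simp: N_def intro: pair_bound_neg)
    then show ?thesis using top(1) PM split[of "\<lambda>j. pair_bound q M (y j)"] by simp
  qed
qed

end

text \<open>The row of the Gram matrix that belongs to a branch of maximal mass sums to zero, whereas
  the pairwise bounds force it to be negative.\<close>

lemma star_degree_le_3_of_subhalf:
  fixes a :: "'b \<Rightarrow> 'a::euclidean_space" and \<mu> :: "'b \<Rightarrow> real"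
  assumes p: "0 < p" "p < 1/2" and N: "finite N" and ne: "\<And>x. x \<in> N \<Longrightarrow> \<mu> x \<noteq> 0"
    and zero: "sum \<mu> N = 0" and cal: "\<And>S. S \<subseteq> N \<Longrightarrow> norm (sum a S) \<le> \<bar>sum \<mu> S\<bar> powr p"
    and nrm: "\<And>x. x \<in> N \<Longrightarrow> norm (a x) = \<bar>\<mu> x\<bar> powr p"
  shows "card N \<le> 3"
proof (rule ccontr)
  assume "\<not> card N \<le> 3"
  then have c4: "4 \<le> card N" by simp
  define q where "q = 2 * p"
  have q: "0 < q" "q < 1" using p by (auto simp: q_def)
  have pq: "(x powr p)\<^sup>2 = x powr q" for x :: real
    by (cases "x = 0") (auto simp: q_def power2_eq_square powr_add[symmetric])
  have Nne: "N \<noteq> {}" using c4 by auto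
  then have "Max ((\<lambda>j. \<bar>\<mu> j\<bar>) ` N) \<in> (\<lambda>j. \<bar>\<mu> j\<bar>) ` N" using N by (intro Max_in) auto
  then obtain i where "i \<in> N" "Max ((\<lambda>j. \<bar>\<mu> j\<bar>) ` N) = \<bar>\<mu> i\<bar>" by auto
  then have i: "i \<in> N" "\<And>j. j \<in> N \<Longrightarrow> \<bar>\<mu> j\<bar> \<le> \<bar>\<mu> i\<bar>"
    using N by (metis, metis Max_ge finite_imageI imageI)
  define M where "M = \<bar>\<mu> i\<bar>"
  define s where "s = sgn (\<mu> i)"
  \<comment> \<open>Signs are normalised so that branch \<open>i\<close> has mass \<open>M\<close>
    and the others, counted in the opposite sense, add up to \<open>M\<close>. The pair of
    \<open>i\<close> and \<open>j\<close> then carries \<open>\<bar>M - y j\<bar>\<close>.\<close>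
  define y where "y = (\<lambda>j. - s * \<mu> j)"
  have M: "0 < M" using ne i by (simp add: M_def)
  have s: "s = 1 \<or> s = -1" "s * \<mu> i = M" using ne[OF i(1)] by (auto simp: s_def M_def sgn_if)
  have aby: "\<bar>y j\<bar> = \<bar>\<mu> j\<bar>" for j using s by (auto simp: y_def)
  have abMy: "\<bar>M - y j\<bar> = \<bar>\<mu> i + \<mu> j\<bar>" for j using s by (auto simp: y_def)
  let ?J = "N - {i}"
  have cJ: "3 \<le> card ?J" using c4 i N by simp
  have "sum y ?J = - s * (sum \<mu> N - \<mu> i)"
    using i N by (simp add: y_def sum_distrib_left[symmetric] sum_negf sum_diff1)
  then have sy: "sum y ?J = M" using zero s by simp
  have lt: "2 * M powr q < (\<Sum>j\<in>?J. pair_bound q M (y j))"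
  proof (rule pair_bound_star[OF q M])
    fix j assume j: "j \<in> ?J"
    show "y j \<noteq> 0" using aby[of j] ne[of j] j by auto
    show "y j \<le> M" using aby[of j] i(2)[of j] j by (auto simp: M_def)
  qed (use N cJ sy in auto)
  have "pair_bound q M (y j) \<le> - 2 * (a i \<bullet> a j)" if j: "j \<in> ?J" for j
  proof -
    have "norm (sum a {i, j}) \<le> \<bar>sum \<mu> {i, j}\<bar> powr p" using i j by (intro cal) auto
    moreover have "i \<noteq> j" using j by auto
    ultimately have "norm (a i + a j) \<le> \<bar>\<mu> i + \<mu> j\<bar> powr p" by simp
    then have "(norm (a i + a j))\<^sup>2 \<le> (\<bar>\<mu> i + \<mu> j\<bar> powr p)\<^sup>2" by (intro power_mono) auto
    also have "(norm (a i + a j))\<^sup>2 = (norm (a i))\<^sup>2 + (norm (a j))\<^sup>2 + 2 * (a i \<bullet> a j)"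
      by (simp add: power2_norm_eq_inner inner_add inner_commute)
    finally have "\<bar>\<mu> i\<bar> powr q + \<bar>\<mu> j\<bar> powr q + 2 * (a i \<bullet> a j) \<le> \<bar>\<mu> i + \<mu> j\<bar> powr q"
      using i j nrm[of i] nrm[of j] by (simp add: pq)
    then show ?thesis by (simp add: pair_bound_def aby abMy) (simp add: M_def)
  qed
  then have "(\<Sum>j\<in>?J. pair_bound q M (y j)) \<le> (\<Sum>j\<in>?J. - 2 * (a i \<bullet> a j))" by (intro sum_mono) auto
  also have "\<dots> = - 2 * (a i \<bullet> (sum a N - a i))"
    using i N by (simp add: sum_negf sum_distrib_left[symmetric] inner_sum_right[symmetric] sum_diff1)
  \<comment> \<open>The set of all branches has total mass zero, so its calibration bound is
    \<open>0 powr p = 0\<close>.\<close>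
  also have "sum a N = 0" using cal[of N] zero by simp
  also have "- 2 * (a i \<bullet> (0 - a i)) = 2 * M powr q"
    using nrm[OF i(1)] pq by (simp add: M_def dot_square_norm)
  finally show False using lt by simp
qed

section \<open>Strict negative type of powers of the distance on the line\<close>

text \<open>Near 0 the bound \<open>1 - cos u \<le> u^2 / 2\<close> leaves a multiple of
  \<open>t powr (1 - q)\<close>, integrable as \<open>q < 2\<close>; at infinity the bound 2 leaves
  \<open>t powr (-1 - q)\<close>, integrable as \<open>0 < q\<close>.\<close>

lemma cos_kernel_absolutely_integrable:
  fixes x q :: real
  assumes "0 < q" "q < 2"
  shows "(\<lambda>t. (1 - cos (t * x)) * t powr (-1 - q)) absolutely_integrable_on {0<..}"
proof -
  define f where "f = (\<lambda>t. (1 - cos (t * x)) * t powr (-1 - q))"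
  have meas: "f \<in> borel_measurable borel" unfolding f_def by measurable
  have 1: "f absolutely_integrable_on {0..1}"
  proof (rule measurable_bounded_by_integrable_imp_absolutely_integrable)
    show "f \<in> borel_measurable (lebesgue_on {0..1})"
      using meas by (simp add: measurable_completion measurable_restrict_space1)
    show "(\<lambda>t. x\<^sup>2 / 2 * t powr (1 - q)) integrable_on {0..1}"
      using has_integral_powr_from_0[of "1 - q" 1] assms
      by (intro integrable_on_mult_right) (auto simp: integrable_on_def)
    fix t :: real assume t: "t \<in> {0..1}"
    have "1 - cos (t * x) = 2 * (sin (t * x / 2))\<^sup>2" using cos_double_sin[of "t * x / 2"] by simp
    also have "\<dots> \<le> 2 * (t * x / 2)\<^sup>2"
      using abs_sin_x_le_abs_x[of "t * x / 2"] unfolding abs_le_square_iff by simp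
    finally have "1 - cos (t * x) \<le> x\<^sup>2 / 2 * t\<^sup>2"
      by (simp add: power_mult_distrib power_divide mult.commute)
    then have "(1 - cos (t * x)) * t powr (-1 - q) \<le> x\<^sup>2 / 2 * t\<^sup>2 * t powr (-1 - q)"
      by (intro mult_right_mono) auto
    also have "t\<^sup>2 * t powr (-1 - q) = t powr (1 - q)"
      using t by (cases "t = 0") (auto simp: powr_add[symmetric] simp flip: powr_numeral)
    then have "x\<^sup>2 / 2 * t\<^sup>2 * t powr (-1 - q) = x\<^sup>2 / 2 * t powr (1 - q)" by (simp only: mult.assoc)
    finally show "norm (f t) \<le> x\<^sup>2 / 2 * t powr (1 - q)" by (simp add: f_def abs_mult)
  qed auto
  have 2: "f absolutely_integrable_on {1..}"
  proof (rule measurable_bounded_by_integrable_imp_absolutely_integrable)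
    show "f \<in> borel_measurable (lebesgue_on {1..})"
      using meas by (simp add: measurable_completion measurable_restrict_space1)
    show "(\<lambda>t. 2 * t powr (-1 - q)) integrable_on {1..}"
      using has_integral_powr_to_inf[of "-1 - q" 1] assms
      by (intro integrable_on_mult_right) (auto simp: integrable_on_def)
    fix t :: real
    have "1 - cos (t * x) \<le> 2" using cos_ge_minus_one[of "t * x"] by linarith
    then show "norm (f t) \<le> 2 * t powr (-1 - q)" by (simp add: f_def abs_mult mult_right_mono)
  qed auto
  have "f absolutely_integrable_on {0..1} \<union> {1..}" using 1 2 by (intro set_integrable_Un) auto
  then show ?thesis unfolding f_def[symmetric] by (rule set_integrable_subset) auto
qed

text \<open>Rescaling the variable by \<open>\<bar>x\<bar>\<close> pulls out the power. Up to a
  constant, \<open>\<bar>x\<bar> powr q\<close> thus becomes a positive superposition of the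
  functions \<open>1 - cos (t * x)\<close>.\<close>

lemma cos_kernel_integral:
  fixes x q :: real
  assumes "0 < q" "q < 2"
  shows "integral {0<..} (\<lambda>t. (1 - cos (t * x)) * t powr (-1 - q))
    = \<bar>x\<bar> powr q * integral {0<..} (\<lambda>t. (1 - cos t) * t powr (-1 - q))"
proof (cases "x = 0")
  case False
  define y where "y = \<bar>x\<bar>"
  have y: "y > 0" using False by (simp add: y_def)
  define f where "f = (\<lambda>t::real. (1 - cos t) * t powr (-1 - q))"
  have im: "(\<lambda>t. t * y) ` {0<..} = {0<..}"
  proof (intro equalityI subsetI)
    fix t :: real assume "t \<in> {0<..}"
    then show "t \<in> (\<lambda>t. t * y) ` {0<..}" using y by (intro image_eqI[of _ _ "t / y"]) auto
  qed (use y in auto)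
  have "f absolutely_integrable_on {0<..}"
    using cos_kernel_absolutely_integrable[OF assms, of 1] by (simp add: f_def)
  moreover have "(\<lambda>t. \<bar>y\<bar> * f (t * y)) absolutely_integrable_on {0<..} \<and>
      integral {0<..} (\<lambda>t. \<bar>y\<bar> * f (t * y)) = integral {0<..} f \<longleftrightarrow>
      f absolutely_integrable_on (\<lambda>t. t * y) ` {0<..} \<and> integral ((\<lambda>t. t * y) ` {0<..}) f = integral {0<..} f"
    by (rule has_absolute_integral_change_of_variables_1')
      (use y in \<open>auto simp: inj_on_def intro!: derivative_eq_intros\<close>)
  ultimately have "integral {0<..} (\<lambda>t. \<bar>y\<bar> * f (t * y)) = integral {0<..} f"
    by (simp only: im simp_thms)
  then have "integral {0<..} f = integral {0<..} (\<lambda>t. y * f (t * y))" by (simp add: y_def)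
  also have "\<dots> = integral {0<..} (\<lambda>t. y powr - q * ((1 - cos (t * x)) * t powr (-1 - q)))"
  proof (rule integral_cong)
    fix t :: real assume t: "t \<in> {0<..}"
    have c: "cos (t * y) = cos (t * x)" by (auto simp: y_def abs_if)
    have "y * y powr (-1 - q) = y powr - q" using y by (simp add: powr_mult_base)
    then show "y * f (t * y) = y powr - q * ((1 - cos (t * x)) * t powr (-1 - q))"
      using t y by (simp add: f_def c powr_mult mult_ac)
  qed
  also have "\<dots> = y powr - q * integral {0<..} (\<lambda>t. (1 - cos (t * x)) * t powr (-1 - q))" by simp
  finally show ?thesis using y by (simp add: f_def y_def[symmetric] powr_minus field_simps)
qed simp

lemma integral_pos_of_continuous:
  fixes f :: "real \<Rightarrow> real"
  assumes int: "f integrable_on {0<..}" and cont: "continuous_on {0<..} f"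
    and nonneg: "\<And>t. 0 < t \<Longrightarrow> 0 \<le> f t" and t0: "0 < t0" "0 < f t0"
  shows "0 < integral {0<..} f"
proof -
  have "isCont f t0" using cont t0 by (simp add: continuous_on_eq_continuous_at)
  then have "\<forall>\<^sub>F t in at t0. f t0 / 2 < f t"
    using t0 by (intro order_tendstoD(1)[of f "f t0"]) (auto simp: isCont_def)
  then obtain d where d: "d > 0" "\<And>t. t \<noteq> t0 \<Longrightarrow> dist t t0 < d \<Longrightarrow> f t0 / 2 < f t"
    by (auto simp: eventually_at)
  define b where "b = t0 + d / 2"
  have b: "t0 < b" using d by (simp add: b_def)
  have ge: "f t0 / 2 \<le> f t" if "t \<in> {t0..b}" for t
    using that d(2)[of t] t0 d(1) by (cases "t = t0") (auto simp: b_def dist_real_def)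
  have intb: "f integrable_on {t0..b}"
    using cont t0 by (intro integrable_continuous_interval) (auto elim: continuous_on_subset)
  have "0 < integral {t0..b} (\<lambda>_. f t0 / 2)" using b t0 by simp
  also have "\<dots> \<le> integral {t0..b} f" using intb ge by (intro integral_le) auto
  also have "\<dots> \<le> integral {0<..} f" using t0 nonneg by (intro integral_subset_le int intb) auto
  finally show ?thesis .
qed

text \<open>Linear independence of characters, here on the positive half-line. Subtracting
  \<open>cis (s * y)\<close> times the relation at \<open>t\<close> from the relation at
  \<open>t + s\<close> eliminates the term of \<open>y\<close>.\<close>

lemma cis_independent:
  fixes c :: "real \<Rightarrow> complex"
  assumes "finite X" "\<And>t. 0 < t \<Longrightarrow> (\<Sum>x\<in>X. c x * cis (t * x)) = 0" "x \<in> X"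
  shows "c x = 0"
  using assms
proof (induction X arbitrary: c x rule: finite_induct)
  case (insert y X)
  have 0: "c z = 0" if z: "z \<in> X" for z
  proof -
    \<comment> \<open>With this shift \<open>cis (s * z) = - cis (s * y)\<close>, so the new
      coefficient of \<open>z\<close> is a non-zero multiple of \<open>c z\<close>.\<close>
    define s where "s = pi / \<bar>z - y\<bar>"
    have ne: "z \<noteq> y" using insert z by auto
    then have s: "s > 0" by (simp add: s_def)
    have "(\<Sum>x\<in>X. (c x * (cis (s * x) - cis (s * y))) * cis (t * x)) = 0" if t: "t > 0" for t
    proof -
      have "(\<Sum>x\<in>insert y X. c x * cis ((t + s) * x)) - cis (s * y) * (\<Sum>x\<in>insert y X. c x * cis (t * x)) = 0"
        using insert.prems(1)[of t] insert.prems(1)[of "t + s"] t s by simp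
      moreover have "cis ((t + s) * x) = cis (t * x) * cis (s * x)" for x
        by (simp add: cis_mult ring_distribs)
      ultimately have "(\<Sum>x\<in>insert y X. c x * (cis (t * x) * cis (s * x)) - cis (s * y) * (c x * cis (t * x))) = 0"
        by (simp only: sum_distrib_left sum_subtractf)
      then have "(\<Sum>x\<in>X. c x * (cis (t * x) * cis (s * x)) - cis (s * y) * (c x * cis (t * x))) = 0"
        using insert.hyps by (simp add: mult_ac)
      then show ?thesis by (simp only: algebra_simps)
    qed
    then have "c z * (cis (s * z) - cis (s * y)) = 0"
      using insert.IH[of "\<lambda>x. c x * (cis (s * x) - cis (s * y))" z] z by simp
    moreover have "cis (s * z) \<noteq> cis (s * y)"
    proof
      assume "cis (s * z) = cis (s * y)"
      then have "cis (s * z) * cis (- (s * y)) = 1" by (simp add: cis_mult)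
      then have "cis (s * (z - y)) = 1" by (simp add: cis_mult right_diff_distrib)
      moreover have "s * (z - y) = pi \<or> s * (z - y) = - pi" using ne by (auto simp: s_def abs_if field_simps)
      ultimately show False by (auto simp: complex_eq_iff)
    qed
    ultimately show ?thesis by simp
  qed
  then have "c y * cis (1 * y) = 0" using insert.prems(1)[of 1] insert.hyps by simp
  then show ?case using 0 insert.prems(2) by auto
qed simp

text \<open>After superposition, minus \<open>I\<close> times the double sum is the integral of
  \<open>h t * w t\<close>, where \<open>h t\<close> is the squared modulus of the sum of
  \<open>c x * cis (t * x)\<close>; the constant part drops out because the weights sum to zero.
  Independence of characters keeps \<open>h\<close> from vanishing identically.\<close>

lemma powr_strict_negative_type:
  fixes X :: "real set" and c :: "real \<Rightarrow> real"
  assumes q: "0 < q" "q < 2" and X: "finite X" and c0: "sum c X = 0" and ne: "x0 \<in> X" "c x0 \<noteq> 0"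
  shows "(\<Sum>x\<in>X. \<Sum>y\<in>X. c x * c y * \<bar>x - y\<bar> powr q) < 0"
proof -
  define w where "w = (\<lambda>t::real. t powr (-1 - q))"
  define h where "h = (\<lambda>t. (\<Sum>x\<in>X. c x * cos (t * x))\<^sup>2 + (\<Sum>x\<in>X. c x * sin (t * x))\<^sup>2)"
  define I where "I = integral {0<..} (\<lambda>t. (1 - cos t) * w t)"
  have h_eq: "(\<Sum>x\<in>X. \<Sum>y\<in>X. c x * c y * (1 - cos (t * (x - y)))) = - h t" for t
  proof -
    have "(\<Sum>x\<in>X. \<Sum>y\<in>X. c x * c y * (1 - cos (t * (x - y)))) =
        (\<Sum>x\<in>X. \<Sum>y\<in>X. c x * c y) - (\<Sum>x\<in>X. \<Sum>y\<in>X. (c x * cos (t * x)) * (c y * cos (t * y)))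
        - (\<Sum>x\<in>X. \<Sum>y\<in>X. (c x * sin (t * x)) * (c y * sin (t * y)))"
      by (simp add: sum_subtractf[symmetric] right_diff_distrib cos_diff algebra_simps)
    then show ?thesis using c0 by (simp add: h_def sum_product[symmetric] power2_eq_square)
  qed
  have int: "(\<lambda>t. (1 - cos (t * x)) * w t) integrable_on {0<..}" for x
    using cos_kernel_absolutely_integrable[OF q, of x]
    by (simp add: w_def absolutely_integrable_on_def)
  have cw: "continuous_on {0<..} w" unfolding w_def by (intro continuous_intros) auto
  have I: "0 < I" unfolding I_def
    by (rule integral_pos_of_continuous[of _ pi])
      (use int[of 1] cw in \<open>auto intro!: continuous_intros mult_nonneg_nonneg simp: w_def\<close>)
  have "\<exists>t0>0. h t0 \<noteq> 0"
  proof (rule ccontr)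
    assume "\<not> ?thesis"
    then have h0: "h t = 0" if "t > 0" for t using that by blast
    have "(\<Sum>x\<in>X. complex_of_real (c x) * cis (t * x)) = 0" if "t > 0" for t
    proof -
      have "(\<Sum>x\<in>X. c x * cos (t * x)) = 0" "(\<Sum>x\<in>X. c x * sin (t * x)) = 0"
        using h0[OF that] unfolding h_def sum_power2_eq_zero_iff by blast+
      then show ?thesis by (intro complex_eqI) simp_all
    qed
    then have "complex_of_real (c x0) = 0" using cis_independent[of X "\<lambda>x. complex_of_real (c x)" x0] X ne(1) by simp
    with ne show False by simp
  qed
  then obtain t0 where t0: "t0 > 0" "h t0 \<noteq> 0" by blast
  have h_nonneg: "0 \<le> h t" for t by (simp add: h_def)
  have eq: "(\<lambda>t. h t * w t) = (\<lambda>t. - (\<Sum>x\<in>X. \<Sum>y\<in>X. c x * c y * ((1 - cos (t * (x - y))) * w t)))"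
  proof
    fix t
    have "h t * w t = - (\<Sum>x\<in>X. \<Sum>y\<in>X. c x * c y * (1 - cos (t * (x - y)))) * w t" by (simp add: h_eq)
    then show "h t * w t = - (\<Sum>x\<in>X. \<Sum>y\<in>X. c x * c y * ((1 - cos (t * (x - y))) * w t))"
      by (simp add: sum_distrib_right mult.assoc)
  qed
  have "0 < integral {0<..} (\<lambda>t. h t * w t)"
  proof (rule integral_pos_of_continuous[OF _ _ _ t0(1)])
    show "(\<lambda>t. h t * w t) integrable_on {0<..}"
      unfolding eq using int X by (intro integrable_neg integrable_sum integrable_on_mult_right) auto
    show "continuous_on {0<..} (\<lambda>t. h t * w t)"
      using cw unfolding h_def by (intro continuous_intros)
    show "0 < h t0 * w t0" using t0 h_nonneg[of t0] by (simp add: w_def less_le)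
  qed (use h_nonneg in \<open>auto simp: w_def\<close>)
  also have "integral {0<..} (\<lambda>t. h t * w t) = - (\<Sum>x\<in>X. \<Sum>y\<in>X. c x * c y * (\<bar>x - y\<bar> powr q * I))"
    unfolding eq using int X cos_kernel_integral[OF q]
    by (simp add: integral_sum integrable_sum integrable_on_mult_right I_def w_def)
  also have "\<dots> = - (\<Sum>x\<in>X. \<Sum>y\<in>X. c x * c y * \<bar>x - y\<bar> powr q) * I"
    by (simp add: sum_distrib_right mult.assoc)
  finally show ?thesis using I by (simp add: mult_less_0_iff)
qed

text \<open>With the image of 0 as origin of the Hilbert space, \<open>K x y\<close> is twice the
  inner product of the images of \<open>x\<close> and \<open>y\<close>, and the expression is the
  squared norm of a combination of three of them. Negative type applies once 0 receives the weight
  that makes the total zero.\<close>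

lemma powr_kernel_positive:
  fixes t1 t2 t3 c1 c2 c3 q :: real
  assumes q: "0 < q" "q < 2" and "t1 \<noteq> 0" "t2 \<noteq> 0" "t3 \<noteq> 0" "t1 \<noteq> t2" "t1 \<noteq> t3" "t2 \<noteq> t3"
    and "c1 \<noteq> 0 \<or> c2 \<noteq> 0 \<or> c3 \<noteq> 0"
  defines "K \<equiv> \<lambda>x y :: real. \<bar>x\<bar> powr q + \<bar>y\<bar> powr q - \<bar>x - y\<bar> powr q"
  shows "0 < c1\<^sup>2 * \<bar>t1\<bar> powr q + c2\<^sup>2 * \<bar>t2\<bar> powr q + c3\<^sup>2 * \<bar>t3\<bar> powr q
     + c1 * c2 * K t1 t2 + c1 * c3 * K t1 t3 + c2 * c3 * K t2 t3"
proof -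
  define c where "c = (\<lambda>t. if t = t1 then c1 else if t = t2 then c2 else if t = t3 then c3 else - (c1 + c2 + c3))"
  have c: "c t1 = c1" "c t2 = c2" "c t3 = c3" "c 0 = - (c1 + c2 + c3)" using assms by (auto simp: c_def)
  have "(\<Sum>x\<in>{0, t1, t2, t3}. \<Sum>y\<in>{0, t1, t2, t3}. c x * c y * \<bar>x - y\<bar> powr q) < 0"
  proof -
    obtain x0 where "x0 \<in> {0, t1, t2, t3}" "c x0 \<noteq> 0" using assms(9) c by auto
    moreover have "sum c {0, t1, t2, t3} = 0" using assms c by simp
    ultimately show ?thesis by (intro powr_strict_negative_type[OF q]) auto
  qed
  then show ?thesis using assms(3-8)
    by (simp add: c K_def abs_minus_commute[of t2 t1] abs_minus_commute[of t3 t1] abs_minus_commute[of t3 t2] algebra_simps power2_eq_square)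
qed

section \<open>Turning angles of closed polygons\<close>

text \<open>The cosine laws alone yield the law of sines with common ratio \<open>k\<close> and the
  projection formula \<open>c = b * cos A + a * cos B\<close>. Multiplied by \<open>k\<close>, the
  latter is the addition formula.\<close>

lemma sin_add_of_law_of_cosines:
  fixes a b c A B C :: real
  assumes pos: "0 < a" "0 < b" "0 < c" and A: "0 < A" "A < pi" and B: "0 < B" "B < pi" and C: "0 < C" "C < pi"
    and a: "a\<^sup>2 = b\<^sup>2 + c\<^sup>2 - 2 * b * c * cos A"
    and b: "b\<^sup>2 = a\<^sup>2 + c\<^sup>2 - 2 * a * c * cos B"
    and c: "c\<^sup>2 = a\<^sup>2 + b\<^sup>2 - 2 * a * b * cos C"
  shows "sin (A + B) = sin C"
proof -
  have sines: "u * sin V = v * sin U"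
    if "0 < u" "0 < v" "0 < w" "0 < U" "U < pi" "0 < V" "V < pi"
      and u: "u\<^sup>2 = v\<^sup>2 + w\<^sup>2 - 2 * v * w * cos U" and v: "v\<^sup>2 = u\<^sup>2 + w\<^sup>2 - 2 * u * w * cos V"
    for u v w U V :: real
  proof (rule power2_eq_imp_eq)
    have "w * (w - v * cos U - u * cos V) = 0" using u v by (simp add: power2_eq_square algebra_simps)
    then have "u * cos V = w - v * cos U" using that by simp
    then have "(u * cos V)\<^sup>2 = (w - v * cos U)\<^sup>2" by simp
    then have "u\<^sup>2 * (1 - (cos V)\<^sup>2) = v\<^sup>2 * (1 - (cos U)\<^sup>2)"
      using u by (simp add: power2_eq_square algebra_simps)
    then show "(u * sin V)\<^sup>2 = (v * sin U)\<^sup>2" by (simp add: power_mult_distrib sin_squared_eq)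
  qed (use that in \<open>auto intro!: mult_nonneg_nonneg sin_ge_zero\<close>)
  have sA: "sin A > 0" using A by (simp add: sin_gt_zero)
  define k where "k = sin A / a"
  have "a * sin B = b * sin A" using pos A B a b by (intro sines)
  moreover have "a * sin C = c * sin A"
  proof (rule sines[of a c b])
    show "a\<^sup>2 = c\<^sup>2 + b\<^sup>2 - 2 * c * b * cos A" by (subst a) simp
  qed (fact pos A C c)+
  ultimately have k: "sin A = k * a" "sin B = k * b" "sin C = k * c" using pos by (auto simp: k_def field_simps)
  have "c * (c - b * cos A - a * cos B) = 0" using a b by (simp add: power2_eq_square algebra_simps)
  then have "c = b * cos A + a * cos B" using pos by simp
  then have "k * c = k * a * cos B + cos A * (k * b)" by (simp add: algebra_simps)
  then show ?thesis by (simp add: sin_add k)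
qed

text \<open>Equal sines leave \<open>A + B = C\<close> or the angle sum \<open>pi\<close>, and
  likewise \<open>B + C = A\<close> or \<open>pi\<close>. Both exceptions together would force
  \<open>B = 0\<close>.\<close>

lemma triangle_angle_sum:
  fixes a b c A B C :: real
  assumes pos: "0 < a" "0 < b" "0 < c" and A: "0 < A" "A < pi" and B: "0 < B" "B < pi" and C: "0 < C" "C < pi"
    and a: "a\<^sup>2 = b\<^sup>2 + c\<^sup>2 - 2 * b * c * cos A"
    and b: "b\<^sup>2 = a\<^sup>2 + c\<^sup>2 - 2 * a * c * cos B"
    and c: "c\<^sup>2 = a\<^sup>2 + b\<^sup>2 - 2 * a * b * cos C"
  shows "A + B + C = pi"
proof -
  have key: "U + V = W \<or> U + V + W = pi"
    if s: "sin (U + V) = sin W" and "0 < U" "U < pi" "0 < V" "V < pi" "0 < W" "W < pi" for U V W :: real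
  proof -
    have lt: "U + V < pi"
    proof (rule ccontr)
      assume "\<not> U + V < pi"
      then have "sin (U + V) \<le> 0" using that by (intro sin_le_zero) auto
      moreover have "0 < sin W" using that by (simp add: sin_gt_zero)
      ultimately show False using s by simp
    qed
    have "2 * sin ((U + V - W) / 2) * cos ((U + V + W) / 2) = 0"
      using sin_diff_sin[of "U + V" W] s by simp
    then consider "sin ((U + V - W) / 2) = 0" | "cos ((U + V + W) / 2) = 0" by auto
    then show ?thesis
    proof cases
      case 1
      then have "(U + V - W) / 2 = 0" using that lt by (intro sin_eq_0_pi[OF _ _ 1]) auto
      then show ?thesis by simp
    next
      case 2
      then have "cos ((U + V + W) / 2) = cos (pi / 2)" unfolding cos_pi_half .
      from cos_inj_pi[OF _ _ _ _ this] have "(U + V + W) / 2 = pi / 2" using that(2-) lt by auto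
      then show ?thesis by simp
    qed
  qed
  have "A + B = C \<or> A + B + C = pi"
    using sin_add_of_law_of_cosines[OF assms] A B C by (intro key) auto
  moreover have "B + C = A \<or> B + C + A = pi"
  proof (intro key sin_add_of_law_of_cosines[of b c a])
    show "b\<^sup>2 = c\<^sup>2 + a\<^sup>2 - 2 * c * a * cos B" by (subst b) simp
    show "c\<^sup>2 = b\<^sup>2 + a\<^sup>2 - 2 * b * a * cos C" using c by (simp only: mult.commute mult.left_commute add.commute)
  qed (fact pos A B C a)+
  ultimately show ?thesis using B by linarith
qed

text \<open>In the Hilbert space in which \<open>\<bar>x - y\<bar> powr p\<close> is the distance between the images of
  the reals \<open>x\<close> and \<open>y\<close>, this is the angle between consecutive edges of a polygon through images of
  points whose successive differences are \<open>x\<close> and \<open>y\<close>. A planar star can only be calibrated if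
  branches of masses \<open>x\<close> and \<open>y\<close> enclose at least this angle.\<close>

definition turn_cos :: "real \<Rightarrow> real \<Rightarrow> real \<Rightarrow> real" where
  "turn_cos p x y = ((\<bar>x + y\<bar> powr p)\<^sup>2 - (\<bar>x\<bar> powr p)\<^sup>2 - (\<bar>y\<bar> powr p)\<^sup>2) / (2 * \<bar>x\<bar> powr p * \<bar>y\<bar> powr p)"

definition turn :: "real \<Rightarrow> real \<Rightarrow> real \<Rightarrow> real" where
  "turn p x y = arccos (turn_cos p x y)"

context
  fixes p :: real
  assumes p: "0 < p" "p < 1"
begin

text \<open>Strict triangle inequality of the metric \<open>\<bar>x - y\<bar> powr p\<close>. It
  keeps \<open>turn_cos\<close> below 1, and above -1 unless the two masses are opposite.\<close>

lemma abs_powr_strict_subadditive: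
  fixes x y :: real
  assumes "x \<noteq> 0" "y \<noteq> 0"
  shows "\<bar>x + y\<bar> powr p < \<bar>x\<bar> powr p + \<bar>y\<bar> powr p"
proof -
  have "\<bar>x + y\<bar> powr p \<le> (\<bar>x\<bar> + \<bar>y\<bar>) powr p" using p by (intro powr_mono2) auto
  also have "\<dots> < \<bar>x\<bar> powr p + \<bar>y\<bar> powr p" using assms p by (intro powr_strict_subadditive) auto
  finally show ?thesis .
qed

lemma turn_commute: "turn p x y = turn p y x"
  by (simp add: turn_def turn_cos_def add.commute mult_ac diff_diff_add)

lemma turn_cos_less_1: "x \<noteq> 0 \<Longrightarrow> y \<noteq> 0 \<Longrightarrow> turn_cos p x y < 1"
proof -
  assume xy: "x \<noteq> 0" "y \<noteq> 0"
  have "(\<bar>x + y\<bar> powr p)\<^sup>2 < (\<bar>x\<bar> powr p + \<bar>y\<bar> powr p)\<^sup>2"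
    using abs_powr_strict_subadditive[OF xy] by (intro power_strict_mono) auto
  then show ?thesis using xy by (simp add: turn_cos_def power2_sum)
qed

lemma turn_cos_ge: "x \<noteq> 0 \<Longrightarrow> y \<noteq> 0 \<Longrightarrow> x + y \<noteq> 0 \<Longrightarrow> - 1 < turn_cos p x y"
proof -
  assume xy: "x \<noteq> 0" "y \<noteq> 0" "x + y \<noteq> 0"
  have "\<bar>x\<bar> powr p < \<bar>x + y\<bar> powr p + \<bar>y\<bar> powr p"
    using abs_powr_strict_subadditive[of "x + y" "- y"] xy by simp
  moreover have "\<bar>y\<bar> powr p < \<bar>x + y\<bar> powr p + \<bar>x\<bar> powr p"
    using abs_powr_strict_subadditive[of "x + y" "- x"] xy by simp
  ultimately have "\<bar>\<bar>x\<bar> powr p - \<bar>y\<bar> powr p\<bar> < \<bar>\<bar>x + y\<bar> powr p\<bar>" by linarith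
  then have "(\<bar>x\<bar> powr p - \<bar>y\<bar> powr p)\<^sup>2 < (\<bar>x + y\<bar> powr p)\<^sup>2" by (meson abs_le_square_iff not_le)
  then have "- (2 * \<bar>x\<bar> powr p * \<bar>y\<bar> powr p) < (\<bar>x + y\<bar> powr p)\<^sup>2 - (\<bar>x\<bar> powr p)\<^sup>2 - (\<bar>y\<bar> powr p)\<^sup>2"
    by (simp add: power2_diff)
  then show ?thesis using xy by (simp add: turn_cos_def less_divide_eq)
qed

lemma turn_cos_opposite: "x \<noteq> 0 \<Longrightarrow> turn_cos p x (- x) = - 1"
  by (simp add: turn_cos_def power2_eq_square field_simps)

lemma turn_opposite: "x \<noteq> 0 \<Longrightarrow> x + y = 0 \<Longrightarrow> turn p x y = pi"
  using turn_cos_opposite[of x] by (simp add: turn_def eq_neg_iff_add_eq_0[symmetric])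

lemma cos_turn:
  assumes "x \<noteq> 0" "y \<noteq> 0"
  shows "cos (turn p x y) = turn_cos p x y" "0 < turn p x y" "turn p x y \<le> pi"
    "x + y \<noteq> 0 \<Longrightarrow> turn p x y < pi"
proof -
  have ge: "- 1 \<le> turn_cos p x y"
    using turn_cos_ge[OF assms] turn_cos_opposite[of x] assms
    by (cases "x + y = 0") (auto simp: eq_neg_iff_add_eq_0[symmetric])
  have lt: "turn_cos p x y < 1" using turn_cos_less_1[OF assms] .
  show "cos (turn p x y) = turn_cos p x y" using ge lt by (simp add: turn_def)
  show "0 < turn p x y" using arccos_less_arccos[of "turn_cos p x y" 1] ge lt by (simp add: turn_def)
  show "turn p x y \<le> pi" using ge lt by (simp add: turn_def arccos_ubound)
  show "turn p x y < pi" if "x + y \<noteq> 0"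
    using arccos_less_arccos[of "- 1" "turn_cos p x y"] turn_cos_ge[OF assms that] lt by (simp add: turn_def)
qed

lemma cos_turn_mult:
  assumes "x \<noteq> 0" "y \<noteq> 0"
  shows "2 * \<bar>x\<bar> powr p * \<bar>y\<bar> powr p * cos (turn p x y)
    = (\<bar>x + y\<bar> powr p)\<^sup>2 - (\<bar>x\<bar> powr p)\<^sup>2 - (\<bar>y\<bar> powr p)\<^sup>2"
  using assms by (simp add: cos_turn(1) turn_cos_def)

text \<open>The turns are the exterior angles of a triangle with sides
  \<open>\<bar>x\<bar> powr p\<close>, \<open>\<bar>y\<bar> powr p\<close> and
  \<open>\<bar>z\<bar> powr p\<close>.\<close>

lemma turn_triangle:
  assumes "x \<noteq> 0" "y \<noteq> 0" "z \<noteq> 0" "x + y + z = 0"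
  shows "turn p x y + turn p y z + turn p z x = 2 * pi"
proof -
  have ne: "x + y \<noteq> 0" "y + z \<noteq> 0" "z + x \<noteq> 0" using assms by auto
  have ab: "\<bar>x + y\<bar> = \<bar>z\<bar>" "\<bar>y + z\<bar> = \<bar>x\<bar>" "\<bar>z + x\<bar> = \<bar>y\<bar>" using assms(4) by linarith+
  have pos: "0 < \<bar>x\<bar> powr p" "0 < \<bar>y\<bar> powr p" "0 < \<bar>z\<bar> powr p" using assms by auto
  have range: "0 < pi - turn p u v \<and> pi - turn p u v < pi" if "u \<noteq> 0" "v \<noteq> 0" "u + v \<noteq> 0" for u v
    using cos_turn(2,4)[OF that(1,2)] that(3) by simp
  have "(pi - turn p y z) + (pi - turn p z x) + (pi - turn p x y) = pi"
  proof (rule triangle_angle_sum[OF pos])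
    show "(\<bar>x\<bar> powr p)\<^sup>2 = (\<bar>y\<bar> powr p)\<^sup>2 + (\<bar>z\<bar> powr p)\<^sup>2 - 2 * \<bar>y\<bar> powr p * \<bar>z\<bar> powr p * cos (pi - turn p y z)"
      using cos_turn_mult[of y z] assms by (simp add: ab)
    show "(\<bar>y\<bar> powr p)\<^sup>2 = (\<bar>x\<bar> powr p)\<^sup>2 + (\<bar>z\<bar> powr p)\<^sup>2 - 2 * \<bar>x\<bar> powr p * \<bar>z\<bar> powr p * cos (pi - turn p z x)"
      using cos_turn_mult[of z x] assms by (simp add: ab mult_ac)
    show "(\<bar>z\<bar> powr p)\<^sup>2 = (\<bar>x\<bar> powr p)\<^sup>2 + (\<bar>y\<bar> powr p)\<^sup>2 - 2 * \<bar>x\<bar> powr p * \<bar>y\<bar> powr p * cos (pi - turn p x y)"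
      using cos_turn_mult[of x y] assms by (simp add: ab)
  qed (use range[of y z] range[of z x] range[of x y] assms ne in blast)+
  then show ?thesis by simp
qed

text \<open>The spherical triangle inequality, strict because the edge vectors involved are linearly
  independent. With \<open>A\<close>, \<open>B\<close> the two angles on the right, the vector whose positive square is used is
  the one that would vanish if the three directions were coplanar.\<close>

lemma turn_merge_less:
  assumes ne: "s \<noteq> 0" "y \<noteq> 0" "z \<noteq> 0" "s \<noteq> y" "s + z \<noteq> 0"
  shows "turn p s z < turn p y z + (pi - turn p y (- s))"
proof -
  define A where "A = pi - turn p y (- s)"
  define B where "B = turn p y z"
  have A: "0 < A" "A < pi" using cos_turn[of y "- s"] ne by (auto simp: A_def)
  have B: "0 < B" "B \<le> pi" using cos_turn[of y z] ne by (auto simp: B_def)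
  have T: "turn p s z < pi" using cos_turn[of s z] ne by auto
  show ?thesis
  \<comment> \<open>In these cases the right-hand side is at least \<open>pi\<close>, whereas the
    left-hand side is below \<open>pi\<close>.\<close>
  proof (cases "y + z = 0 \<or> A + B \<ge> pi")
    case True
    then show ?thesis using T A turn_opposite[of y z] ne by (auto simp: A_def B_def)
  next
    case False
    then have yz: "y + z \<noteq> 0" and AB: "A + B < pi" by auto
    then have Blt: "B < pi" using A by simp
    define r where "r = (\<lambda>x::real. \<bar>x\<bar> powr p)"
    have r: "r s > 0" "r y > 0" "r z > 0" using ne by (auto simp: r_def)
    have sq: "(r x)\<^sup>2 = \<bar>x\<bar> powr (2 * p)" for x
      by (cases "x = 0") (auto simp: r_def power2_eq_square powr_add[symmetric])
    have rm: "r (- x) = r x" for x by (simp add: r_def)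
    have sA: "0 < sin A" and sB: "0 < sin B" using A B Blt by (auto intro: sin_gt_zero)
    have KA: "(r s)\<^sup>2 + (r y)\<^sup>2 - (r (y - s))\<^sup>2 = 2 * r s * r y * cos A"
      using cos_turn_mult[of y "- s"] ne by (simp add: A_def r_def mult_ac)
    have KB: "(r y)\<^sup>2 + (r z)\<^sup>2 - (r (y + z))\<^sup>2 = - (2 * r y * r z * cos B)"
      using cos_turn_mult[of y z] ne by (simp add: B_def r_def)
    have KC: "(r s)\<^sup>2 + (r z)\<^sup>2 - (r (s + z))\<^sup>2 = - (2 * r s * r z * cos (turn p s z))"
      using cos_turn_mult[of s z] ne by (simp add: r_def)
    define c1 c2 c3 where "c1 = sin B / r s" and "c2 = - sin (A + B) / r y" and "c3 = - sin A / r z"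
    \<comment> \<open>The origin is the vertex between the edges \<open>y\<close> and
      \<open>z\<close>. The images of \<open>- s\<close> and \<open>- y\<close> enclose the angle
      \<open>A\<close>, those of \<open>- y\<close> and \<open>z\<close> the angle
      \<open>pi - B\<close>.\<close>
    have "0 < c1\<^sup>2 * \<bar>-s\<bar> powr (2 * p) + c2\<^sup>2 * \<bar>-y\<bar> powr (2 * p) + c3\<^sup>2 * \<bar>z\<bar> powr (2 * p)
       + c1 * c2 * (\<bar>-s\<bar> powr (2 * p) + \<bar>-y\<bar> powr (2 * p) - \<bar>-s - -y\<bar> powr (2 * p))
       + c1 * c3 * (\<bar>-s\<bar> powr (2 * p) + \<bar>z\<bar> powr (2 * p) - \<bar>-s - z\<bar> powr (2 * p))
       + c2 * c3 * (\<bar>-y\<bar> powr (2 * p) + \<bar>z\<bar> powr (2 * p) - \<bar>-y - z\<bar> powr (2 * p))"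
      by (rule powr_kernel_positive) (use p ne yz sB r in \<open>auto simp: c1_def\<close>)
    also have "\<dots> = c1\<^sup>2 * (r s)\<^sup>2 + c2\<^sup>2 * (r y)\<^sup>2 + c3\<^sup>2 * (r z)\<^sup>2 + c1 * c2 * (2 * r s * r y * cos A)
      + c1 * c3 * (- (2 * r s * r z * cos (turn p s z))) + c2 * c3 * (- (2 * r y * r z * cos B))"
    proof -
      have e: "- s - - y = y - s" "- s - z = - (s + z)" "- y - z = - (y + z)" by simp_all
      show ?thesis unfolding sq[symmetric] e rm KA KB KC ..
    qed
    also have "\<dots> = (sin B)\<^sup>2 + (sin (A + B))\<^sup>2 + (sin A)\<^sup>2 - 2 * sin B * sin (A + B) * cos A
       + 2 * sin A * sin B * cos (turn p s z) - 2 * sin A * sin (A + B) * cos B"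
      using r by (simp add: c1_def c2_def c3_def power_divide field_simps power2_eq_square)
    also have "\<dots> = 2 * (sin A * sin B) * (cos (turn p s z) - cos (A + B))"
    proof -
      have "(cos A)\<^sup>2 = 1 - (sin A)\<^sup>2" "(cos B)\<^sup>2 = 1 - (sin B)\<^sup>2" by (simp_all add: cos_squared_eq)
      then show ?thesis unfolding sin_add cos_add by algebra
    qed
    finally have "0 < 2 * (sin A * sin B) * (cos (turn p s z) - cos (A + B))" .
    moreover have "0 < 2 * (sin A * sin B)" using sA sB by simp
    ultimately have "0 < cos (turn p s z) - cos (A + B)" by (rule zero_less_mult_pos)
    then have "cos (A + B) < cos (turn p s z)" by simp
    then have "turn p s z < A + B"
      using cos_turn[of s z] ne AB A B by (subst (asm) cos_mono_less_eq) auto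
    then show ?thesis by (simp add: A_def B_def)
  qed
qed

text \<open>Adds the degenerate case \<open>s + z = 0\<close>, in which both sides equal
  \<open>pi\<close>.\<close>

lemma turn_merge:
  assumes "s \<noteq> 0" "y \<noteq> 0" "z \<noteq> 0" "s \<noteq> y"
  shows "turn p s z \<le> turn p y z + (pi - turn p y (- s))"
proof (cases "s + z = 0")
  case True
  then have "z = - s" by simp
  then show ?thesis using turn_opposite[of s "- s"] assms by simp
next
  case False
  with assms show ?thesis by (intro less_imp_le turn_merge_less)
qed

end

section \<open>Total turning of a closed polygon\<close>

fun path_sum :: "('a \<Rightarrow> 'a \<Rightarrow> real) \<Rightarrow> 'a list \<Rightarrow> real" where
  "path_sum g (x # y # xs) = g x y + path_sum g (y # xs)"
| "path_sum g xs = 0"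

lemma path_sum_map: "path_sum g (map f xs) = path_sum (\<lambda>x y. g (f x) (f y)) xs"
  by (induction xs rule: induct_list012) auto

text \<open>Fenchel's theorem on the total curvature of closed polygons, in its strict form.\<close>

lemma total_turn:
  assumes p: "0 < p" "p < 1" and "0 \<notin> set xs" "sum_list xs = 0" "3 \<le> length xs"
  shows "2 * pi \<le> path_sum (turn p) xs + turn p (last xs) (hd xs) \<and>
    (4 \<le> length xs \<longrightarrow> 2 * pi < path_sum (turn p) xs + turn p (last xs) (hd xs))"
  using assms(3-)
proof (induction "length xs" arbitrary: xs rule: less_induct)
  case less
  then obtain x y z r where xs: "xs = x # y # z # r"
    by (metis Suc_le_length_iff numeral_3_eq_3)
  have ne: "x \<noteq> 0" "y \<noteq> 0" "z \<noteq> 0" using less.prems xs by auto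
  show ?case
  proof (cases r)
    case Nil
    then show ?thesis using turn_triangle[OF p ne] less.prems xs by (simp add: add_ac)
  next
    case (Cons w r')
    define l where "l = last (w # r')"
    have l0: "l \<in> set (w # r')" unfolding l_def by (rule last_in_set) simp
    then have l: "l \<noteq> 0" using less.prems(1) xs Cons by auto
    have w: "w \<noteq> 0" using less.prems xs Cons by auto
    define R where "R = path_sum (turn p) (z # w # r')"
    have val: "path_sum (turn p) xs + turn p (last xs) (hd xs) = turn p x y + turn p y z + R + turn p l x"
      by (simp add: xs Cons R_def l_def)
    have "2 * pi < turn p x y + turn p y z + R + turn p l x"
    \<comment> \<open>If \<open>x\<close> and \<open>y\<close> cancel, their turn is
      \<open>pi\<close>. The other edges form a closed path whose turns, even without the closing
      one, reach \<open>pi\<close>.\<close>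
    proof (cases "x + y = 0")
      case True
      then have s0: "sum_list (z # w # r') = 0" using less.prems xs Cons by simp
      have "pi \<le> R"
      proof (cases r')
        case Nil
        then have "z + w = 0" using s0 by simp
        then show ?thesis using turn_opposite[OF p ne(3), of w] Nil by (simp add: R_def)
      next
        case (Cons v r'')
        have "2 * pi \<le> R + turn p l z"
          using less.hyps[of "z # w # r'"] less.prems s0 xs \<open>r = w # r'\<close> Cons by (simp add: R_def l_def)
        then show ?thesis using cos_turn(3)[OF p l ne(3)] by linarith
      qed
      then show ?thesis
        using turn_opposite[OF p ne(1) True] cos_turn(2)[OF p ne(2,3)] cos_turn(2)[OF p l ne(1)] by linarith
    next
      case False
      \<comment> \<open>The first two edges are replaced by their sum. The corrections that
        \<open>turn_merge\<close> allows at its two ends add up, by the triangle \<open>x\<close>,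
        \<open>y\<close>, \<open>- ?s\<close>, to exactly the lost
        \<open>turn p x y\<close>.\<close>
      let ?s = "x + y"
      have IH: "2 * pi \<le> turn p ?s z + R + turn p l ?s \<and> (r' \<noteq> [] \<longrightarrow> 2 * pi < turn p ?s z + R + turn p l ?s)"
        using less.hyps[of "?s # z # w # r'"] less.prems False xs Cons
        by (cases r') (auto simp: R_def l_def add_ac)
      have tri: "turn p x y + turn p y (- ?s) + turn p x (- ?s) = 2 * pi"
        using turn_triangle[OF p ne(1,2), of "- ?s"] False by (simp add: turn_commute[OF p, of "- x - y" x])
      have m1: "turn p ?s z \<le> turn p y z + (pi - turn p y (- ?s))"
        using turn_merge[OF p False ne(2,3)] ne by simp
      have m2: "turn p l ?s \<le> turn p l x + (pi - turn p x (- ?s))"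
        using turn_merge[OF p False ne(1) l] ne by (simp add: turn_commute[OF p, of l])
      \<comment> \<open>A quadrilateral shrinks to a triangle, for which the induction hypothesis is
        not strict; strictness then comes from this merge.\<close>
      have m3: "turn p ?s z < turn p y z + (pi - turn p y (- ?s))" if "r' = []"
      proof -
        have "?s + z = - w" using less.prems(2) xs Cons that by simp
        then have "?s + z \<noteq> 0" using w by simp
        then show ?thesis using turn_merge_less[OF p False ne(2,3)] ne by simp
      qed
      show ?thesis
        using IH tri m1 m2 m3 by (cases "r' = []") linarith+
    qed
    then show ?thesis using val by simp
  qed
qed

section \<open>Planar stars\<close>

lemma angle_le_of_cos_le:
  fixes e t :: real
  assumes "cos e \<le> cos t" "0 \<le> e" "0 \<le> t" "t \<le> pi"
  shows "t \<le> e"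
proof (cases "e \<le> pi")
  case True
  then show ?thesis using assms cos_mono_le_eq[of e t] by simp
qed (use assms in simp)

lemma path_sum_sorted_le:
  fixes \<theta> :: "'a \<Rightarrow> real"
  assumes "\<And>i j. i \<in> N \<Longrightarrow> j \<in> N \<Longrightarrow> i \<noteq> j \<Longrightarrow> \<theta> i \<le> \<theta> j \<Longrightarrow> g i j \<le> \<theta> j - \<theta> i"
    and "ys \<noteq> []" "distinct ys" "sorted (map \<theta> ys)" "set ys \<subseteq> N"
  shows "path_sum g ys \<le> \<theta> (last ys) - \<theta> (hd ys)"
  using assms(2-)
proof (induction ys rule: induct_list012)
  case (3 x y zs)
  have "path_sum g (y # zs) \<le> \<theta> (last (y # zs)) - \<theta> y" using 3 by simp
  moreover have "g x y \<le> \<theta> y - \<theta> x" using 3 by (intro assms(1)) auto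
  ultimately show ?case by simp
qed auto

text \<open>Sorted by argument, the directions leave angular gaps that add up to
  \<open>2 * pi\<close>. Each gap is at least the turn of the two masses, and the masses close up to
  a polygon because they sum to zero.\<close>

lemma planar_star_degree_le_3:
  fixes a :: "'b \<Rightarrow> complex" and \<mu> :: "'b \<Rightarrow> real"
  assumes p: "0 < p" "p < 1" and N: "finite N" and ne: "\<And>x. x \<in> N \<Longrightarrow> \<mu> x \<noteq> 0"
    and zero: "sum \<mu> N = 0"
    and cal: "\<And>i j. i \<in> N \<Longrightarrow> j \<in> N \<Longrightarrow> i \<noteq> j \<Longrightarrow> norm (a i + a j) \<le> \<bar>\<mu> i + \<mu> j\<bar> powr p"
    and nrm: "\<And>x. x \<in> N \<Longrightarrow> norm (a x) = \<bar>\<mu> x\<bar> powr p"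
  shows "card N \<le> 3"
proof (rule ccontr)
  assume "\<not> card N \<le> 3"
  then have c4: "4 \<le> card N" by simp
  define \<theta> where "\<theta> = (\<lambda>i. Arg2pi (a i))"
  define g where "g = (\<lambda>i j. turn p (\<mu> i) (\<mu> j))"
  have \<theta>: "0 \<le> \<theta> i" "\<theta> i < 2 * pi" for i
    using Arg2pi_ge_0[of "a i"] Arg2pi_lt_2pi[of "a i"] by (auto simp: \<theta>_def)
  have coords: "Re (a i) = norm (a i) * cos (\<theta> i)" "Im (a i) = norm (a i) * sin (\<theta> i)" for i
  proof -
    have e: "a i = norm (a i) * cis (\<theta> i)"
      using Arg2pi_eq[of "a i"] by (simp add: \<theta>_def cis_conv_exp)
    show "Re (a i) = norm (a i) * cos (\<theta> i)" "Im (a i) = norm (a i) * sin (\<theta> i)"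
      using arg_cong[OF e, of Re] arg_cong[OF e, of Im] by simp_all
  qed
  \<comment> \<open>The cosine does not distinguish the two arcs between the directions, so both are
    bounded; the second bound serves the gap that closes the circle.\<close>
  have gap: "g i j \<le> \<theta> j - \<theta> i \<and> g i j \<le> 2 * pi - (\<theta> j - \<theta> i)"
    if ij: "i \<in> N" "j \<in> N" "i \<noteq> j" and le: "\<theta> i \<le> \<theta> j" for i j
  proof -
    define r s where "r = \<bar>\<mu> i\<bar> powr p" and "s = \<bar>\<mu> j\<bar> powr p"
    have rs: "0 < r" "0 < s" using ne ij by (auto simp: r_def s_def)
    have "a i \<bullet> a j = r * s * cos (\<theta> j - \<theta> i)"
      unfolding inner_complex_def coords nrm[OF ij(1)] nrm[OF ij(2)]
      by (simp add: cos_diff r_def s_def algebra_simps)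
    moreover have "(norm (a i + a j))\<^sup>2 = (norm (a i))\<^sup>2 + (norm (a j))\<^sup>2 + 2 * (a i \<bullet> a j)"
      by (simp add: power2_norm_eq_inner inner_add inner_commute)
    moreover have "(norm (a i + a j))\<^sup>2 \<le> (\<bar>\<mu> i + \<mu> j\<bar> powr p)\<^sup>2"
      using cal[OF ij] by (intro power_mono) auto
    ultimately have "r\<^sup>2 + s\<^sup>2 + 2 * (r * s * cos (\<theta> j - \<theta> i)) \<le> (\<bar>\<mu> i + \<mu> j\<bar> powr p)\<^sup>2"
      using nrm ij by (simp add: r_def s_def)
    moreover have "2 * r * s * cos (g i j) = (\<bar>\<mu> i + \<mu> j\<bar> powr p)\<^sup>2 - r\<^sup>2 - s\<^sup>2"
      using cos_turn_mult[OF p, of "\<mu> i" "\<mu> j"] ne ij by (simp add: r_def s_def g_def)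
    ultimately have "(2 * r * s) * cos (\<theta> j - \<theta> i) \<le> (2 * r * s) * cos (g i j)" by (simp add: mult.assoc)
    then have c: "cos (\<theta> j - \<theta> i) \<le> cos (g i j)" using rs by (subst (asm) mult_le_cancel_left_pos) auto
    have gp: "0 < g i j" "g i j \<le> pi" using cos_turn[OF p] ne ij by (auto simp: g_def)
    have c': "cos (2 * pi - (\<theta> j - \<theta> i)) \<le> cos (g i j)" using c unfolding cos_diff[of "2 * pi"] by simp
    show ?thesis
      using angle_le_of_cos_le[OF c] angle_le_of_cos_le[OF c'] gp le \<theta>(1)[of i] \<theta>(2)[of j] by linarith
  qed
  obtain xs where xs: "set xs = N" "distinct xs" using finite_distinct_list[OF N] by blast
  define ys where "ys = sort_key \<theta> xs"
  have ys: "set ys = N" "distinct ys" "sorted (map \<theta> ys)" using xs by (auto simp: ys_def)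
  have len: "length ys = card N" using ys distinct_card by metis
  then obtain x zs where cons: "ys = x # zs" "zs \<noteq> []" using c4 by (cases ys; cases "tl ys") auto
  have last: "last ys \<in> set zs" "last ys \<in> N" "x \<in> N" using cons ys(1) by auto
  have "path_sum g ys \<le> \<theta> (last ys) - \<theta> (hd ys)"
    using gap ys cons by (intro path_sum_sorted_le[of N]) auto
  moreover have "g x (last ys) \<le> 2 * pi - (\<theta> (last ys) - \<theta> x)"
  proof -
    have "x \<noteq> l \<and> \<theta> x \<le> \<theta> l" if "l \<in> set zs" for l using that ys(2,3) cons(1) by auto
    then show ?thesis using gap[of x "last ys"] last by blast
  qed
  moreover have "2 * pi < path_sum (turn p) (map \<mu> ys) + turn p (last (map \<mu> ys)) (hd (map \<mu> ys))"
  proof -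
    have "0 \<notin> set (map \<mu> ys)" using ne ys by auto
    moreover have "sum_list (map \<mu> ys) = 0" using zero ys by (simp add: sum_list_distinct_conv_sum_set)
    ultimately show ?thesis using total_turn[OF p] len c4 by simp
  qed
  moreover have "path_sum (turn p) (map \<mu> ys) = path_sum g ys" by (simp add: path_sum_map g_def)
  moreover have "turn p (last (map \<mu> ys)) (hd (map \<mu> ys)) = g x (last ys)"
    using cons turn_commute[OF p, of "\<mu> x"] by (simp add: g_def last_map)
  moreover have "hd ys = x" using cons by simp
  ultimately show False by simp
qed

section \<open>Calibrated lower bounds\<close>

text \<open>Replacing the set by its image shrinks it until it is mapped onto itself.\<close>

lemma finite_map_has_invariant_subset:
  assumes "finite Y" "Y \<noteq> {}" "f ` Y \<subseteq> Y"
  obtains U where "U \<subseteq> Y" "U \<noteq> {}" "f ` U = U"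
proof -
  have "\<exists>U\<subseteq>Y. U \<noteq> {} \<and> f ` U = U" using assms
  proof (induction Y rule: finite_psubset_induct)
    case (psubset Y)
    show ?case
    proof (cases "f ` Y = Y")
      case False
      then have "f ` Y \<subset> Y" using psubset.prems(2) by (rule psubsetI[rotated])
      moreover have "f ` Y \<noteq> {}" "f ` f ` Y \<subseteq> f ` Y"
        using psubset.prems by (auto intro: image_mono)
      ultimately obtain U where U: "U \<subseteq> f ` Y" "U \<noteq> {}" "f ` U = U"
        using psubset.IH[of "f ` Y"] by auto
      show ?thesis
        by (rule exI[of _ U]) (use U psubset.prems(2) in auto)
    next
      case True
      then show ?thesis using psubset.prems(1) by (intro exI[of _ Y]) simp
    qed
  qed
  then show ?thesis using that by blast
qed

text \<open>Removal of circulations: in a finite network in which every vertex with an outgoing arc has an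
  incoming one, following incoming arcs backwards is a map that permutes some set of vertices, and a
  constant flow can be subtracted along the arcs that it uses.\<close>

lemma remove_circulation:
  fixes A :: "'a \<Rightarrow> 'a \<Rightarrow> real"
  assumes W: "finite W" and A: "\<And>x y. 0 \<le> A x y"
    and arc: "u \<in> W" "v \<in> W" "A u v \<noteq> 0"
    and pre: "\<And>v w. v \<in> W \<Longrightarrow> w \<in> W \<Longrightarrow> A v w \<noteq> 0 \<Longrightarrow> \<exists>x\<in>W. A x v \<noteq> 0"
  shows "\<exists>A'. (\<forall>x y. 0 \<le> A' x y) \<and> (\<forall>x y. A' x y \<le> A x y) \<and>
    (\<forall>z\<in>W. (\<Sum>y\<in>W. A' z y) - (\<Sum>x\<in>W. A' x z) = (\<Sum>y\<in>W. A z y) - (\<Sum>x\<in>W. A x z)) \<and>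
    {(x, y) \<in> W \<times> W. A' x y \<noteq> 0} \<subset> {(x, y) \<in> W \<times> W. A x y \<noteq> 0}"
proof -
  define Y where "Y = {v \<in> W. \<exists>y\<in>W. A v y \<noteq> 0}"
  have "\<forall>v\<in>Y. \<exists>x\<in>Y. A x v \<noteq> 0" using pre by (fastforce simp: Y_def)
  then obtain pr where pr: "\<And>v. v \<in> Y \<Longrightarrow> pr v \<in> Y \<and> A (pr v) v \<noteq> 0" by metis
  have "finite Y" "Y \<noteq> {}" "pr ` Y \<subseteq> Y" using W arc pr by (auto simp: Y_def)
  then obtain U where U: "U \<subseteq> Y" "U \<noteq> {}" "pr ` U = U" by (rule finite_map_has_invariant_subset)
  have UW: "U \<subseteq> W" using U by (auto simp: Y_def)
  have finU: "finite U" using UW W finite_subset by blast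
  \<comment> \<open>A finite set mapped onto itself is permuted, so every vertex of \<open>U\<close>
    has exactly one incoming and one outgoing arc of the form from \<open>pr y\<close> to
    \<open>y\<close>.\<close>
  have inj: "inj_on pr U" using finU U(3) by (intro eq_card_imp_inj_on) auto
  \<comment> \<open>The least mass on these arcs can be subtracted from all of them and removes the
    arc into \<open>w0\<close> altogether.\<close>
  define e where "e = Min ((\<lambda>w. A (pr w) w) ` U)"
  have "e \<in> (\<lambda>w. A (pr w) w) ` U" unfolding e_def using finU U by (intro Min_in) auto
  then obtain w0 where w0: "w0 \<in> U" "e = A (pr w0) w0" by auto
  have e_le: "e \<le> A (pr w) w" if "w \<in> U" for w unfolding e_def using finU that by (intro Min_le) auto
  have e0: "e \<ge> 0" using w0 A by simp
  define D where "D = (\<lambda>x y. if y \<in> U \<and> x = pr y then e else 0)"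
  show ?thesis
  proof (intro exI[of _ "\<lambda>x y. A x y - D x y"] conjI allI ballI)
    fix x y
    show "0 \<le> A x y - D x y" using e_le A by (auto simp: D_def)
    show "A x y - D x y \<le> A x y" using e0 by (auto simp: D_def)
  next
    fix z assume z: "z \<in> W"
    have "(\<Sum>y\<in>W. D z y) = (if z \<in> U then e else 0)"
    proof (cases "z \<in> U")
      case True
      then obtain y where y: "y \<in> U" "z = pr y" using U(3) by auto
      have "(\<Sum>y\<in>W. D z y) = (\<Sum>y\<in>{y}. D z y)"
        using y inj UW W by (intro sum.mono_neutral_right) (auto simp: D_def inj_on_def)
      then show ?thesis using y True by (simp add: D_def)
    next
      case False
      then have "D z y = 0" for y using U(3) by (auto simp: D_def)
      then show ?thesis using False by simp
    qed
    moreover have "(\<Sum>x\<in>W. D x z) = (if z \<in> U then e else 0)"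
    proof -
      have "pr z \<in> W" if "z \<in> U" using that U(3) UW by blast
      then show ?thesis using W by (auto simp: D_def)
    qed
    ultimately show "(\<Sum>y\<in>W. A z y - D z y) - (\<Sum>x\<in>W. A x z - D x z) = (\<Sum>y\<in>W. A z y) - (\<Sum>x\<in>W. A x z)"
      by (simp add: sum_subtractf)
  next
    have nz: "A (pr w) w \<noteq> 0" "pr w \<in> W" "w \<in> W" if "w \<in> U" for w using pr[of w] U(1) UW that by (auto simp: Y_def)
    have "A x y \<noteq> 0" if "A x y - D x y \<noteq> 0" for x y using that nz(1) by (auto simp: D_def split: if_splits)
    moreover have "A (pr w0) w0 - D (pr w0) w0 = 0" using w0 by (simp add: D_def)
    ultimately show "{(x, y) \<in> W \<times> W. A x y - D x y \<noteq> 0} \<subset> {(x, y) \<in> W \<times> W. A x y \<noteq> 0}"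
      using nz[OF w0(1)] by blast
  qed
qed

text \<open>Commodity \<open>i\<close> is supplied with density \<open>\<sigma> i\<close> and calibrated by \<open>a i\<close>; everything is sent to
  the sink \<open>y0\<close>. A vertex without incoming arcs sends its supply along its outgoing arcs in
  proportion to their masses.\<close>

lemma calibrated_lower_bound:
  fixes a :: "'n::finite \<Rightarrow> 'a::euclidean_space" and A :: "'a \<Rightarrow> 'a \<Rightarrow> real" and \<sigma> :: "'n \<Rightarrow> 'a \<Rightarrow> real"
  assumes cal: "\<And>\<theta>. (\<And>i. 0 \<le> \<theta> i \<and> \<theta> i \<le> 1) \<Longrightarrow> norm (\<Sum>i\<in>UNIV. \<theta> i *\<^sub>R a i) \<le> (\<Sum>i\<in>UNIV. \<theta> i) powr p"
    and p: "0 < p" and W: "finite W" "y0 \<in> W"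
    and "\<And>x y. 0 \<le> A x y" "\<And>i x. 0 \<le> \<sigma> i x" "\<And>i. sum (\<sigma> i) W \<le> 1"
    and "\<And>z. z \<in> W \<Longrightarrow> z \<noteq> y0 \<Longrightarrow> (\<Sum>y\<in>W. A z y) - (\<Sum>x\<in>W. A x z) = (\<Sum>i\<in>UNIV. \<sigma> i z)"
  shows "(\<Sum>i\<in>UNIV. a i \<bullet> (\<Sum>x\<in>W. \<sigma> i x *\<^sub>R (y0 - x))) \<le> (\<Sum>x\<in>W. \<Sum>y\<in>W. A x y powr p * dist x y)"
  using assms(5-)
proof (induction "card {(x, y) \<in> W \<times> W. A x y \<noteq> 0}" arbitrary: A \<sigma> rule: less_induct)
  case less
  note A = less.prems(1) and \<sigma> = less.prems(2) and mass = less.prems(3) and bal = less.prems(4)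
  have fin: "finite {(x, y) \<in> W \<times> W. B x y \<noteq> 0}" for B :: "'a \<Rightarrow> 'a \<Rightarrow> real"
    using W by (auto intro: finite_subset[of _ "W \<times> W"])
  consider (source) v u where "v \<in> W" "v \<noteq> y0" "u \<in> W" "A v u \<noteq> 0" "\<And>x. x \<in> W \<Longrightarrow> A x v = 0"
    | (none) "\<And>x y. x \<in> W \<Longrightarrow> y \<in> W \<Longrightarrow> A x y = 0"
    | (cycle) u v where "u \<in> W" "v \<in> W" "A u v \<noteq> 0"
      "\<And>v w. v \<in> W \<Longrightarrow> w \<in> W \<Longrightarrow> v \<noteq> y0 \<Longrightarrow> A v w \<noteq> 0 \<Longrightarrow> \<exists>x\<in>W. A x v \<noteq> 0"
    by metis
  then show ?case
  proof cases
    case none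
    \<comment> \<open>Without arcs, the balance leaves no supply away from \<open>y0\<close>, and
      supply at \<open>y0\<close> has nowhere to go.\<close>
    have "\<sigma> i x *\<^sub>R (y0 - x) = 0" if x: "x \<in> W" for i x
    proof (cases "x = y0")
      case False
      have "(\<Sum>i\<in>UNIV. \<sigma> i x) = 0" using bal[OF x False] none x by simp
      then have "\<sigma> i x = 0" using \<sigma> by (subst (asm) sum_nonneg_eq_0_iff) auto
      then show ?thesis by simp
    qed simp
    then have "(\<Sum>x\<in>W. \<sigma> i x *\<^sub>R (y0 - x)) = 0" for i by (intro sum.neutral) auto
    then show ?thesis using A by (simp add: sum_nonneg)
  next
    case cycle
    \<comment> \<open>No balance is prescribed at \<open>y0\<close>. All balances sum to zero and
      the others are non-negative, so an outgoing arc at \<open>y0\<close> forces an incoming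
      one.\<close>
    have pre: "\<exists>x\<in>W. A x v \<noteq> 0" if vw: "v \<in> W" "w \<in> W" "A v w \<noteq> 0" for v w
    proof (cases "v = y0")
      case True
      have "(\<Sum>z\<in>W. (\<Sum>y\<in>W. A z y) - (\<Sum>x\<in>W. A x z)) = 0"
        unfolding sum_subtractf by (subst sum.swap) simp
      then have "((\<Sum>y\<in>W. A y0 y) - (\<Sum>x\<in>W. A x y0)) + (\<Sum>z\<in>W - {y0}. (\<Sum>y\<in>W. A z y) - (\<Sum>x\<in>W. A x z)) = 0"
        using sum.remove[OF W, of "\<lambda>z. (\<Sum>y\<in>W. A z y) - (\<Sum>x\<in>W. A x z)"] by simp
      moreover have "0 \<le> (\<Sum>z\<in>W - {y0}. (\<Sum>y\<in>W. A z y) - (\<Sum>x\<in>W. A x z))"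
        using bal \<sigma> by (intro sum_nonneg) (simp add: sum_nonneg)
      moreover have "0 < (\<Sum>y\<in>W. A y0 y)"
        using W A vw True by (intro sum_pos2[of W w]) (auto simp: less_le)
      ultimately have "(\<Sum>x\<in>W. A x y0) \<noteq> 0" by linarith
      then show ?thesis using True by (meson sum.neutral)
    qed (use cycle vw in blast)
    have "\<exists>A'. (\<forall>x y. 0 \<le> A' x y) \<and> (\<forall>x y. A' x y \<le> A x y) \<and>
      (\<forall>z\<in>W. (\<Sum>y\<in>W. A' z y) - (\<Sum>x\<in>W. A' x z) = (\<Sum>y\<in>W. A z y) - (\<Sum>x\<in>W. A x z)) \<and>
      {(x, y) \<in> W \<times> W. A' x y \<noteq> 0} \<subset> {(x, y) \<in> W \<times> W. A x y \<noteq> 0}"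
      by (rule remove_circulation[of W A u v, OF W(1) A cycle(1-3)]) (rule pre)
    then obtain A' where A': "\<forall>x y. 0 \<le> A' x y" "\<forall>x y. A' x y \<le> A x y"
      "\<forall>z\<in>W. (\<Sum>y\<in>W. A' z y) - (\<Sum>x\<in>W. A' x z) = (\<Sum>y\<in>W. A z y) - (\<Sum>x\<in>W. A x z)"
      and sub: "{(x, y) \<in> W \<times> W. A' x y \<noteq> 0} \<subset> {(x, y) \<in> W \<times> W. A x y \<noteq> 0}"
      by (elim exE conjE)
    have "(\<Sum>i\<in>UNIV. a i \<bullet> (\<Sum>x\<in>W. \<sigma> i x *\<^sub>R (y0 - x))) \<le> (\<Sum>x\<in>W. \<Sum>y\<in>W. A' x y powr p * dist x y)"
      using A' \<sigma> mass bal by (intro less.hyps psubset_card_mono[OF fin sub]) auto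
    also have "\<dots> \<le> (\<Sum>x\<in>W. \<Sum>y\<in>W. A x y powr p * dist x y)"
      using A' p by (intro sum_mono mult_right_mono powr_mono2) auto
    finally show ?thesis .
  next
    case source
    define S where "S = (\<Sum>y\<in>W. A v y)"
    have S_eq: "S = (\<Sum>i\<in>UNIV. \<sigma> i v)" using bal[of v] source by (simp add: S_def)
    have S: "0 < S" unfolding S_def using W A source by (intro sum_pos2[of W u]) (auto simp: less_le)
    define \<kappa> where "\<kappa> = (\<lambda>y. A v y / S)"
    have \<kappa>: "0 \<le> \<kappa> y" for y using A S by (simp add: \<kappa>_def)
    have \<kappa>1: "sum \<kappa> W = 1" using S by (simp add: \<kappa>_def sum_divide_distrib[symmetric] S_def[symmetric])
    have \<kappa>le: "\<kappa> y \<le> 1" if "y \<in> W" for y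
      using member_le_sum[of y W \<kappa>] that W \<kappa> \<kappa>1 by simp
    have \<kappa>v: "\<kappa> v = 0" using source by (simp add: \<kappa>_def)
    \<comment> \<open>The arcs out of \<open>v\<close> are deleted and their load is booked as
      supply at their heads, every commodity being split in the same proportions
      \<open>\<kappa>\<close>.\<close>
    define A' where "A' = (\<lambda>x y. if x = v then 0 else A x y)"
    define \<sigma>' where "\<sigma>' = (\<lambda>i y. (if y = v then 0 else \<sigma> i y) + \<kappa> y * \<sigma> i v)"
    \<comment> \<open>Used with \<open>h\<close> constantly 1 for the total supplies and with
      \<open>h x = y0 - x\<close> for the displacements in the bound.\<close>
    have mom: "(\<Sum>x\<in>W. \<sigma>' i x *\<^sub>R h x) = (\<Sum>x\<in>W. \<sigma> i x *\<^sub>R h x) + \<sigma> i v *\<^sub>R ((\<Sum>y\<in>W. \<kappa> y *\<^sub>R h y) - h v)"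
      for i and h :: "'a \<Rightarrow> 'b::real_vector"
    proof -
      have "(\<Sum>x\<in>W. \<sigma>' i x *\<^sub>R h x) = (\<Sum>x\<in>W. (if x = v then 0 else \<sigma> i x *\<^sub>R h x) + \<sigma> i v *\<^sub>R \<kappa> x *\<^sub>R h x)"
        by (intro sum.cong) (auto simp: \<sigma>'_def scaleR_add_left mult.commute)
      also have "\<dots> = (\<Sum>x\<in>W - {v}. \<sigma> i x *\<^sub>R h x) + \<sigma> i v *\<^sub>R (\<Sum>y\<in>W. \<kappa> y *\<^sub>R h y)"
        using W source(1) by (simp add: sum.distrib scaleR_sum_right scaleR_add_right sum.remove[of W v])
      finally show ?thesis
        using sum.remove[OF W(1) source(1), of "\<lambda>x. \<sigma> i x *\<^sub>R h x"] by (simp add: scaleR_diff_right)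
    qed
    have "(\<Sum>i\<in>UNIV. a i \<bullet> (\<Sum>x\<in>W. \<sigma>' i x *\<^sub>R (y0 - x))) \<le> (\<Sum>x\<in>W. \<Sum>y\<in>W. A' x y powr p * dist x y)"
    proof (rule less.hyps)
      have "{(x, y) \<in> W \<times> W. A' x y \<noteq> 0} \<subset> {(x, y) \<in> W \<times> W. A x y \<noteq> 0}"
        using source by (auto simp: A'_def)
      then show "card {(x, y) \<in> W \<times> W. A' x y \<noteq> 0} < card {(x, y) \<in> W \<times> W. A x y \<noteq> 0}"
        by (intro psubset_card_mono fin)
      show "0 \<le> A' x y" for x y using A by (simp add: A'_def)
      show "0 \<le> \<sigma>' i x" for i x using \<sigma> \<kappa> by (simp add: \<sigma>'_def)
      show "sum (\<sigma>' i) W \<le> 1" for i using mom[of i "\<lambda>_. 1::real"] \<kappa>1 mass[of i] by simp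
      fix z assume z: "z \<in> W" "z \<noteq> y0"
      show "(\<Sum>y\<in>W. A' z y) - (\<Sum>x\<in>W. A' x z) = (\<Sum>i\<in>UNIV. \<sigma>' i z)"
      proof (cases "z = v")
        case True
        have "(\<Sum>x\<in>W. A' x v) = 0" using source(5) by (intro sum.neutral) (auto simp: A'_def)
        then show ?thesis using True \<kappa>v by (simp add: A'_def \<sigma>'_def)
      next
        case False
        have "(\<Sum>x\<in>W. A' x z) = (\<Sum>x\<in>W. A x z) - A v z"
          using W source(1) by (simp add: A'_def sum.remove[of W v])
        moreover have "(\<Sum>i\<in>UNIV. \<sigma>' i z) = (\<Sum>i\<in>UNIV. \<sigma> i z) + \<kappa> z * S"
          using False by (simp add: \<sigma>'_def sum.distrib S_eq sum_distrib_left)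
        moreover have "\<kappa> z * S = A v z" using S by (simp add: \<kappa>_def)
        moreover have "(\<Sum>y\<in>W. A' z y) = (\<Sum>y\<in>W. A z y)" using False by (simp add: A'_def)
        ultimately show ?thesis using bal[OF z] by simp
      qed
    qed
    moreover have "(\<Sum>x\<in>W. \<Sum>y\<in>W. A x y powr p * dist x y)
      = (\<Sum>x\<in>W. \<Sum>y\<in>W. A' x y powr p * dist x y) + (\<Sum>y\<in>W. A v y powr p * dist v y)"
      using W source(1) by (simp add: A'_def sum.remove[of W v])
    moreover have "(\<Sum>i\<in>UNIV. a i \<bullet> (\<Sum>x\<in>W. \<sigma> i x *\<^sub>R (y0 - x)))
      = (\<Sum>i\<in>UNIV. a i \<bullet> (\<Sum>x\<in>W. \<sigma>' i x *\<^sub>R (y0 - x))) + (\<Sum>y\<in>W. (\<Sum>i\<in>UNIV. (\<kappa> y * \<sigma> i v) *\<^sub>R a i) \<bullet> (y - v))"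
    proof -
      have "(\<Sum>y\<in>W. \<kappa> y *\<^sub>R (y0 - y)) - (y0 - v) = - (\<Sum>y\<in>W. \<kappa> y *\<^sub>R (y - v))"
        using \<kappa>1 by (simp add: scaleR_diff_right sum_subtractf scaleR_sum_left[symmetric])
      then have "(\<Sum>x\<in>W. \<sigma> i x *\<^sub>R (y0 - x)) = (\<Sum>x\<in>W. \<sigma>' i x *\<^sub>R (y0 - x)) + \<sigma> i v *\<^sub>R (\<Sum>y\<in>W. \<kappa> y *\<^sub>R (y - v))" for i
        using mom[of i "\<lambda>x. y0 - x"] by simp
      then have "(\<Sum>i\<in>UNIV. a i \<bullet> (\<Sum>x\<in>W. \<sigma> i x *\<^sub>R (y0 - x)))
        = (\<Sum>i\<in>UNIV. a i \<bullet> (\<Sum>x\<in>W. \<sigma>' i x *\<^sub>R (y0 - x))) + (\<Sum>i\<in>UNIV. \<Sum>y\<in>W. \<sigma> i v * (\<kappa> y * (a i \<bullet> (y - v))))"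
        by (simp add: inner_add_right sum.distrib inner_sum_right sum_distrib_left)
      also have "(\<Sum>i\<in>UNIV. \<Sum>y\<in>W. \<sigma> i v * (\<kappa> y * (a i \<bullet> (y - v)))) = (\<Sum>y\<in>W. (\<Sum>i\<in>UNIV. (\<kappa> y * \<sigma> i v) *\<^sub>R a i) \<bullet> (y - v))"
        by (subst sum.swap) (simp add: inner_sum_left mult_ac)
      finally show ?thesis .
    qed
    \<comment> \<open>On the arc from \<open>v\<close> to \<open>y\<close> the weights
      \<open>\<kappa> y * \<sigma> i v\<close> lie in the unit interval and add up to
      \<open>A v y\<close>, so the calibration is at most the cost of the arc.\<close>
    moreover have "(\<Sum>y\<in>W. (\<Sum>i\<in>UNIV. (\<kappa> y * \<sigma> i v) *\<^sub>R a i) \<bullet> (y - v)) \<le> (\<Sum>y\<in>W. A v y powr p * dist v y)"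
    proof (rule sum_mono)
      fix y assume y: "y \<in> W"
      have \<sigma>1: "\<sigma> i v \<le> 1" for i
        using member_le_sum[of v W "\<sigma> i"] source(1) W \<sigma> mass[of i] by simp
      have "norm (\<Sum>i\<in>UNIV. (\<kappa> y * \<sigma> i v) *\<^sub>R a i) \<le> (\<Sum>i\<in>UNIV. \<kappa> y * \<sigma> i v) powr p"
        using \<kappa>[of y] \<kappa>le[OF y] \<sigma> \<sigma>1 by (intro cal) (auto simp: mult_le_one)
      also have "(\<Sum>i\<in>UNIV. \<kappa> y * \<sigma> i v) = A v y"
        using S unfolding sum_distrib_left[symmetric] S_eq[symmetric] by (simp add: \<kappa>_def)
      finally have "norm (\<Sum>i\<in>UNIV. (\<kappa> y * \<sigma> i v) *\<^sub>R a i) * norm (y - v) \<le> A v y powr p * norm (y - v)"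
        by (intro mult_right_mono) auto
      then show "(\<Sum>i\<in>UNIV. (\<kappa> y * \<sigma> i v) *\<^sub>R a i) \<bullet> (y - v) \<le> A v y powr p * dist v y"
        using norm_cauchy_schwarz[of "\<Sum>i\<in>UNIV. (\<kappa> y * \<sigma> i v) *\<^sub>R a i" "y - v"]
        by (simp add: dist_norm norm_minus_commute)
    qed
    ultimately show ?thesis by linarith
  qed
qed

text \<open>Since \<open>m\<close> is antisymmetric and non-zero on edges, exactly one orientation
  of each edge carries positive mass.\<close>

lemma flow_arc_sum:
  fixes F :: "'a \<Rightarrow> 'a \<Rightarrow> real"
  assumes fl: "is_flow mp mm V E m" and F: "\<And>x y. {x, y} \<in> E \<Longrightarrow> F x y = F y x"
  shows "(\<Sum>e\<in>E. edge_val F e) = (\<Sum>x\<in>V. \<Sum>y\<in>V. if {x, y} \<in> E \<and> 0 < m x y then F x y else 0)"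
proof -
  note f = is_flowD[OF fl]
  define P where "P = {(x, y) \<in> V \<times> V. {x, y} \<in> E \<and> 0 < m x y}"
  have bij: "bij_betw (\<lambda>(x, y). {x, y}) P E"
  proof (rule bij_betw_imageI)
    show "inj_on (\<lambda>(x, y). {x, y}) P"
    proof (rule inj_onI, clarify)
      fix x y x' y' assume xy: "(x, y) \<in> P" "(x', y') \<in> P" "{x, y} = {x', y'}"
      have "m x y = - m y x" using f(5) xy(1) by (auto simp: P_def)
      then show "x = x' \<and> y = y'" using xy by (auto simp: P_def doubleton_eq_iff)
    qed
    show "(\<lambda>(x, y). {x, y}) ` P = E"
    proof (intro equalityI subsetI)
      fix e assume e: "e \<in> E"
      then obtain x y where xy: "e = {x, y}" "x \<in> V" "y \<in> V" using is_flow_edgeE[OF fl e] by metis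
      have "m x y \<noteq> 0" "m x y = - m y x" using f(4,5) e xy by auto
      then have "0 < m x y \<or> 0 < m y x" by linarith
      then have "(x, y) \<in> P \<or> (y, x) \<in> P" using e xy by (auto simp: P_def insert_commute)
      then show "e \<in> (\<lambda>(x, y). {x, y}) ` P" using xy by (auto simp: image_iff insert_commute)
    qed (auto simp: P_def)
  qed
  have "(\<Sum>e\<in>E. edge_val F e) = (\<Sum>(x, y)\<in>P. edge_val F {x, y})"
    using sum.reindex_bij_betw[OF bij, of "edge_val F"] by (simp add: split_beta)
  also have "\<dots> = (\<Sum>(x, y)\<in>P. F x y)"
    by (intro sum.cong) (auto simp: P_def intro!: edge_val_doubleton F)
  also have "\<dots> = (\<Sum>(x, y)\<in>V \<times> V. if {x, y} \<in> E \<and> 0 < m x y then F x y else 0)"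
  proof -
    have "P = {xy \<in> V \<times> V. {fst xy, snd xy} \<in> E \<and> 0 < m (fst xy) (snd xy)}" by (auto simp: P_def)
    then show ?thesis using f(1) by (simp add: split_beta sum.inter_filter)
  qed
  finally show ?thesis by (simp add: sum.cartesian_product)
qed

section \<open>Equiangular stars\<close>

text \<open>The graph of a concave power lies above its chord over the interval from 1 to
  \<open>d\<close>. For \<open>r = 2 * p - 1\<close> the slope of that chord is
  \<open>common_inner p d\<close>.\<close>

lemma powr_ge_chord:
  fixes r x d :: real
  assumes r: "0 \<le> r" "r \<le> 1" and x: "1 \<le> x" "x \<le> d" and d: "1 < d"
  shows "1 + (d powr r - 1) / (d - 1) * (x - 1) \<le> x powr r"
proof -
  have "concave_on {1..d} (\<lambda>x. x powr r)"
  proof (rule f''_le0_imp_concave)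
    fix x assume "x \<in> {1..d}"
    then have x: "0 < x" by simp
    show "((\<lambda>x. x powr r) has_real_derivative r * x powr (r - 1)) (at x)"
      using x by (auto intro!: derivative_eq_intros)
    show "((\<lambda>x. r * x powr (r - 1)) has_real_derivative r * ((r - 1) * x powr (r - 1 - 1))) (at x)"
      using x by (auto intro!: derivative_eq_intros)
    show "r * ((r - 1) * x powr (r - 1 - 1)) \<le> 0"
      using r by (intro mult_nonneg_nonpos mult_nonpos_nonneg) auto
  qed simp
  moreover define t where "t = (x - 1) / (d - 1)"
  moreover have "0 \<le> t" "t \<le> 1" using x d by (auto simp: t_def)
  ultimately have "(1 - t) * 1 powr r + t * d powr r \<le> ((1 - t) *\<^sub>R 1 + t *\<^sub>R d) powr r"
    using d by (intro concave_onD) auto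
  moreover have "(1 - t) *\<^sub>R 1 + t *\<^sub>R d = x"
  proof -
    have "t * (d - 1) = x - 1" using d by (simp add: t_def)
    then show ?thesis by (simp add: algebra_simps)
  qed
  ultimately have "1 + t * (d powr r - 1) \<le> x powr r" by (simp add: algebra_simps)
  then show ?thesis by (simp add: t_def mult.commute)
qed

text \<open>The common inner product of \<open>d\<close> unit vectors whose sum has norm \<open>d powr p\<close>.\<close>

definition common_inner :: "real \<Rightarrow> real \<Rightarrow> real" where
  "common_inner p d = (d powr (2 * p - 1) - 1) / (d - 1)"

lemma common_inner_bounds:
  assumes d: "2 \<le> d" and p: "1/2 \<le> p" "p < 1"
  shows "0 \<le> common_inner p d" "common_inner p d < 1"
proof -
  have "d powr (2 * p - 1) \<ge> 1" using d p by (intro ge_one_powr_ge_zero) auto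
  then show "0 \<le> common_inner p d" using d by (simp add: common_inner_def)
  have "d powr (2 * p - 1) < d powr 1" using d p by (intro powr_less_mono) auto
  then show "common_inner p d < 1" using d by (simp add: common_inner_def)
qed

text \<open>With \<open>s\<close> the sum and \<open>Q\<close> the sum of squares of the weights,
  the squared norm is \<open>(1 - g) * Q + g * s^2\<close>. For \<open>s \<le> 1\<close> the bound
  \<open>Q \<le> s^2\<close> suffices; for larger \<open>s\<close> it is \<open>Q \<le> s\<close>
  with the chord inequality, which is sharp at \<open>s = d\<close>.\<close>

lemma equiangular_calibration:
  fixes a :: "'n::finite \<Rightarrow> 'a::euclidean_space"
  assumes d: "d = real CARD('n)" "2 \<le> d" and p: "1/2 \<le> p" "p < 1"
    and g: "g = common_inner p d"
    and a: "\<And>i j. a i \<bullet> a j = (if i = j then 1 else g)"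
  shows "norm (\<Sum>i\<in>UNIV. a i) = d powr p"
    and "(\<And>i. 0 \<le> \<theta> i \<and> \<theta> i \<le> 1) \<Longrightarrow> norm (\<Sum>i\<in>UNIV. \<theta> i *\<^sub>R a i) \<le> (\<Sum>i\<in>UNIV. \<theta> i) powr p"
proof -
  note g0 = common_inner_bounds(1)[OF d(2) p, folded g] and g1 = common_inner_bounds(2)[OF d(2) p, folded g]
  have nrm: "(norm (\<Sum>i\<in>UNIV. \<theta> i *\<^sub>R a i))\<^sup>2 = (1 - g) * (\<Sum>i\<in>UNIV. (\<theta> i)\<^sup>2) + g * (\<Sum>i\<in>UNIV. \<theta> i)\<^sup>2" for \<theta>
  proof -
    have "(norm (\<Sum>i\<in>UNIV. \<theta> i *\<^sub>R a i))\<^sup>2 = (\<Sum>i\<in>UNIV. \<Sum>j\<in>UNIV. \<theta> i * \<theta> j * (a i \<bullet> a j))"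
      by (simp add: power2_norm_eq_inner inner_sum_left inner_sum_right sum_distrib_left mult_ac inner_commute)
    also have "\<dots> = (\<Sum>i\<in>UNIV. \<Sum>j\<in>UNIV. (1 - g) * (if i = j then (\<theta> i)\<^sup>2 else 0) + g * (\<theta> i * \<theta> j))"
      by (intro sum.cong) (auto simp: a power2_eq_square algebra_simps)
    also have "\<dots> = (1 - g) * (\<Sum>i\<in>UNIV. (\<theta> i)\<^sup>2) + g * (\<Sum>i\<in>UNIV. \<theta> i)\<^sup>2"
      by (simp add: sum.distrib sum_distrib_left[symmetric] sum_product power2_eq_square[of "sum _ _"])
    finally show ?thesis .
  qed
  have sq: "(x powr p)\<^sup>2 = x powr (2 * p)" for x :: real
    by (cases "x = 0") (auto simp: power2_eq_square powr_add[symmetric])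
  have dd: "d * d powr (2 * p - 1) = d powr (2 * p)" using d by (simp add: powr_mult_base)
  have "(1 - g) * d + g * d\<^sup>2 = d * (1 + g * (d - 1))" by (simp add: power2_eq_square algebra_simps)
  also have "g * (d - 1) = d powr (2 * p - 1) - 1" using d by (simp add: g common_inner_def)
  finally have "(1 - g) * d + g * d\<^sup>2 = (d powr p)\<^sup>2" by (simp add: sq dd)
  then have "(norm (\<Sum>i\<in>UNIV. a i))\<^sup>2 = (d powr p)\<^sup>2" using nrm[of "\<lambda>_. 1"] by (simp add: d(1)[symmetric])
  then show "norm (\<Sum>i\<in>UNIV. a i) = d powr p" by (rule power2_eq_imp_eq) auto
  assume \<theta>: "\<And>i. 0 \<le> \<theta> i \<and> \<theta> i \<le> 1"
  define s where "s = (\<Sum>i\<in>UNIV. \<theta> i)"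
  define Q where "Q = (\<Sum>i\<in>UNIV. (\<theta> i)\<^sup>2)"
  have s0: "0 \<le> s" unfolding s_def using \<theta> by (intro sum_nonneg) auto
  have sd: "s \<le> d" unfolding s_def d(1) using sum_mono[of UNIV \<theta> "\<lambda>_. 1"] \<theta> by simp
  have Qs: "Q \<le> s" unfolding Q_def s_def using \<theta> by (intro sum_mono) (auto simp: power2_eq_square mult_left_le)
  have Qs2: "Q \<le> s\<^sup>2"
  proof -
    have "\<theta> i \<le> s" for i unfolding s_def using \<theta> by (intro member_le_sum) auto
    then have "Q \<le> (\<Sum>i\<in>UNIV. \<theta> i * s)"
      unfolding Q_def using \<theta> by (intro sum_mono) (auto simp: power2_eq_square intro!: mult_left_mono)
    also have "\<dots> = s\<^sup>2" by (simp add: sum_distrib_right[symmetric] s_def[symmetric] power2_eq_square)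
    finally show ?thesis .
  qed
  have "(1 - g) * Q + g * s\<^sup>2 \<le> s powr (2 * p)"
  proof (cases "s \<le> 1")
    case True
    have "(1 - g) * Q \<le> (1 - g) * s\<^sup>2" using Qs2 g1 by (intro mult_left_mono) auto
    then have "(1 - g) * Q + g * s\<^sup>2 \<le> s\<^sup>2" by (simp add: algebra_simps)
    also have "s\<^sup>2 \<le> s powr (2 * p)"
    proof (cases "s = 0")
      case False
      then have "s powr 2 \<le> s powr (2 * p)" using s0 True p by (intro powr_mono') auto
      then show ?thesis using False s0 by simp
    qed simp
    finally show ?thesis .
  next
    case False
    have "(1 - g) * Q \<le> (1 - g) * s" using Qs g1 by (intro mult_left_mono) auto
    then have "(1 - g) * Q + g * s\<^sup>2 \<le> s * (1 + g * (s - 1))" by (simp add: algebra_simps power2_eq_square)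
    also have "\<dots> \<le> s * s powr (2 * p - 1)"
      using False d p sd unfolding g common_inner_def
      by (intro mult_left_mono powr_ge_chord) auto
    also have "\<dots> = s powr (2 * p)" using False by (simp add: powr_mult_base)
    finally show ?thesis .
  qed
  then have "(norm (\<Sum>i\<in>UNIV. \<theta> i *\<^sub>R a i))\<^sup>2 \<le> (s powr p)\<^sup>2" using nrm[of \<theta>] by (simp add: s_def Q_def sq)
  then show "norm (\<Sum>i\<in>UNIV. \<theta> i *\<^sub>R a i) \<le> (\<Sum>i\<in>UNIV. \<theta> i) powr p"
    unfolding s_def by (rule power2_le_imp_le) simp
qed

text \<open>Each vector is \<open>\<alpha>\<close> times a basis vector plus \<open>\<beta>\<close>
  times the all-ones vector; \<open>\<beta>\<close> is a root of the quadratic equation that makes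
  the mutual inner products \<open>g\<close>.\<close>

lemma equiangular_exists:
  fixes g :: real
  assumes g: "0 \<le> g" "g < 1"
  obtains a :: "'n::finite \<Rightarrow> real^'n" where "\<And>i j. a i \<bullet> a j = (if i = j then 1 else g)"
proof -
  define d where "d = real CARD('n)"
  have d: "d > 0" by (simp add: d_def)
  define \<alpha> where "\<alpha> = sqrt (1 - g)"
  have \<alpha>: "\<alpha>\<^sup>2 = 1 - g" using g by (simp add: \<alpha>_def)
  define \<beta> where "\<beta> = (sqrt (\<alpha>\<^sup>2 + d * g) - \<alpha>) / d"
  have "(d * \<beta> + \<alpha>)\<^sup>2 = \<alpha>\<^sup>2 + d * g" using d g by (simp add: \<beta>_def)
  then have "d * (d * \<beta>\<^sup>2 + 2 * \<alpha> * \<beta>) = d * g" by (simp add: power2_eq_square algebra_simps)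
  then have \<beta>: "d * \<beta>\<^sup>2 + 2 * \<alpha> * \<beta> = g" using d by simp
  define a where "a = (\<lambda>i::'n. (\<chi> k. \<alpha> * (if k = i then 1 else 0) + \<beta>))"
  have "a i \<bullet> a j = (if i = j then 1 else g)" for i j
  proof -
    have "a i \<bullet> a j = (\<Sum>k\<in>UNIV. \<alpha>\<^sup>2 * (if k = i then (if k = j then 1 else 0) else 0)
        + \<alpha> * \<beta> * (if k = i then 1 else 0) + \<alpha> * \<beta> * (if k = j then 1 else 0) + \<beta>\<^sup>2)"
      unfolding inner_vec_def by (intro sum.cong) (auto simp: a_def algebra_simps power2_eq_square)
    also have "\<dots> = \<alpha>\<^sup>2 * (if i = j then 1 else 0) + (d * \<beta>\<^sup>2 + 2 * \<alpha> * \<beta>)"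
      by (simp add: sum.distrib sum_distrib_left[symmetric] d_def)
    finally show ?thesis by (simp add: \<alpha> \<beta>)
  qed
  then show ?thesis by (rule that)
qed

text \<open>Divergence is inflow minus outflow and equals \<open>mp - mm\<close>, so the points
  \<open>y i\<close> are unit sources and \<open>y0\<close> is the sink. Commodity \<open>i\<close>
  is the unit supplied at \<open>y i\<close>.\<close>

lemma flow_ge_calibration:
  fixes a :: "'n::finite \<Rightarrow> 'a::euclidean_space" and y :: "'n \<Rightarrow> 'a"
  assumes cal: "\<And>\<theta>. (\<And>i. 0 \<le> \<theta> i \<and> \<theta> i \<le> 1) \<Longrightarrow> norm (\<Sum>i\<in>UNIV. \<theta> i *\<^sub>R a i) \<le> (\<Sum>i\<in>UNIV. \<theta> i) powr p"
    and p: "0 < p" and fl: "is_flow mp mm V E m"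
    and y: "inj y" "y0 \<notin> range y"
    and mp: "mp = (\<lambda>x. if x = y0 then real CARD('n) else 0)"
    and mm: "mm = (\<lambda>x. if x \<in> range y then 1 else 0)"
  shows "(\<Sum>i\<in>UNIV. a i \<bullet> (y0 - y i)) \<le> gilbert p E m"
proof -
  note f = is_flowD[OF fl]
  define A where "A = (\<lambda>u v. if {u, v} \<in> E \<and> 0 < m u v then m u v else 0)"
  define \<sigma> where "\<sigma> = (\<lambda>i x. if x = y i then 1 else 0 :: real)"
  have "mp y0 - mm y0 \<noteq> 0" using y by (simp add: mp mm)
  then have y0V: "y0 \<in> V" using f(7) by blast
  have yV: "y i \<in> V" for i
  proof -
    have "mp (y i) - mm (y i) \<noteq> 0" using y by (auto simp: mp mm)
    then show ?thesis using f(7) by blast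
  qed
  have "(\<Sum>i\<in>UNIV. a i \<bullet> (\<Sum>x\<in>V. \<sigma> i x *\<^sub>R (y0 - x))) \<le> (\<Sum>x\<in>V. \<Sum>y\<in>V. A x y powr p * dist x y)"
  proof (rule calibrated_lower_bound[OF cal p f(1) y0V])
    show "0 \<le> A u v" for u v by (simp add: A_def)
    show "0 \<le> \<sigma> i x" for i x by (simp add: \<sigma>_def)
    show "sum (\<sigma> i) V \<le> 1" for i using f(1) by (simp add: \<sigma>_def)
    fix z assume z: "z \<in> V" "z \<noteq> y0"
    have sym: "unit_div m z u v = unit_div m z v u" if "{u, v} \<in> E" for u v
      using f(5)[OF that] by (auto simp: unit_div_def algebra_simps)
    have "mp z - mm z = (\<Sum>u\<in>V. \<Sum>v\<in>V. if {u, v} \<in> E \<and> 0 < m u v then unit_div m z u v else 0)"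
      unfolding f(6) flow_div_alt by (rule flow_arc_sum[OF fl sym])
    also have "\<dots> = (\<Sum>u\<in>V. \<Sum>v\<in>V. (if v = z then A u v else 0) - (if u = z then A u v else 0))"
      by (intro sum.cong) (auto simp: unit_div_def A_def)
    also have "\<dots> = (\<Sum>u\<in>V. A u z) - (\<Sum>v\<in>V. A z v)"
    proof -
      have "(\<Sum>u\<in>V. \<Sum>v\<in>V. if u = z then A u v else 0) = (\<Sum>u\<in>V. if u = z then (\<Sum>v\<in>V. A z v) else 0)"
        by (intro sum.cong) auto
      then show ?thesis using f(1) z by (simp add: sum_subtractf)
    qed
    finally have "(\<Sum>v\<in>V. A z v) - (\<Sum>u\<in>V. A u z) = mm z" using z by (simp add: mp)
    also have "mm z = (\<Sum>i\<in>UNIV. \<sigma> i z)"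
    proof (cases "z \<in> range y")
      case True
      then obtain j where j: "z = y j" by auto
      have "\<sigma> i z = (if i = j then 1 else 0)" for i using y(1) by (auto simp: \<sigma>_def j inj_eq)
      then show ?thesis using True by (simp add: mm)
    next
      case False
      then have "\<sigma> i z = 0" for i by (auto simp: \<sigma>_def)
      then show ?thesis using False by (simp add: mm)
    qed
    finally show "(\<Sum>v\<in>V. A z v) - (\<Sum>u\<in>V. A u z) = (\<Sum>i\<in>UNIV. \<sigma> i z)" .
  qed
  also have "(\<Sum>x\<in>V. \<Sum>y\<in>V. A x y powr p * dist x y) = gilbert p E m"
  proof -
    have sym: "edge_cost p m u v = edge_cost p m v u" if "{u, v} \<in> E" for u v
      using f(5)[OF that] by (simp add: edge_cost_def dist_commute)
    have "gilbert p E m = (\<Sum>u\<in>V. \<Sum>v\<in>V. if {u, v} \<in> E \<and> 0 < m u v then edge_cost p m u v else 0)"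
      unfolding gilbert_alt by (rule flow_arc_sum[OF fl sym])
    also have "\<dots> = (\<Sum>x\<in>V. \<Sum>y\<in>V. A x y powr p * dist x y)"
      by (intro sum.cong) (auto simp: A_def edge_cost_def)
    finally show ?thesis by simp
  qed
  also have "(\<Sum>i\<in>UNIV. a i \<bullet> (\<Sum>x\<in>V. \<sigma> i x *\<^sub>R (y0 - x))) = (\<Sum>i\<in>UNIV. a i \<bullet> (y0 - y i))"
  proof -
    have "(\<Sum>x\<in>V. \<sigma> i x *\<^sub>R (y0 - x)) = (\<Sum>x\<in>V. if x = y i then y0 - x else 0)" for i
      by (intro sum.cong) (auto simp: \<sigma>_def)
    then have "(\<Sum>x\<in>V. \<sigma> i x *\<^sub>R (y0 - x)) = y0 - y i" for i using yV[of i] f(1) by simp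
    then show ?thesis by simp
  qed
  finally show ?thesis .
qed

text \<open>The hub is the origin; the point \<open>x\<close> has to send out
  \<open>mm x - mp x\<close>, which determines the mass on its only edge.\<close>

lemma star_flow:
  fixes mp mm :: "'a::real_normed_vector \<Rightarrow> real"
  assumes T: "finite T" "0 \<notin> T" and u: "\<And>x. x \<in> T \<Longrightarrow> mm x - mp x \<noteq> 0"
    and out: "\<And>x. x \<notin> T \<Longrightarrow> mp x = mm x" and tot: "(\<Sum>x\<in>T. mm x - mp x) = 0"
  defines "E \<equiv> (\<lambda>x. {x, 0}) ` T"
    and "m \<equiv> \<lambda>x y. if y = 0 then mm x - mp x else if x = 0 then mp y - mm y else 0"
  shows "is_flow mp mm (insert 0 T) E m" "gilbert p E m = (\<Sum>x\<in>T. \<bar>mm x - mp x\<bar> powr p * norm x)"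
    "card E = card T"
proof -
  have inj: "inj_on (\<lambda>x. {x, 0}) T" using T by (auto simp: inj_on_def doubleton_eq_iff)
  then show "card E = card T" by (simp add: E_def card_image)
  have anti: "m x 0 = - m 0 x" if "x \<in> T" for x using that T by (auto simp: m_def)
  have "gilbert p E m = (\<Sum>x\<in>T. edge_val (edge_cost p m) {x, 0})"
    by (simp add: gilbert_alt E_def sum.reindex[OF inj])
  also have "\<dots> = (\<Sum>x\<in>T. \<bar>mm x - mp x\<bar> powr p * norm x)"
  proof (intro sum.cong refl)
    fix x assume "x \<in> T"
    then show "edge_val (edge_cost p m) {x, 0} = \<bar>mm x - mp x\<bar> powr p * norm x"
      using edge_val_edge_cost[of m x 0 p, OF anti] by (simp add: edge_cost_def m_def)
  qed
  finally show "gilbert p E m = (\<Sum>x\<in>T. \<bar>mm x - mp x\<bar> powr p * norm x)" .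
  show "is_flow mp mm (insert 0 T) E m"
    unfolding is_flow_def
  proof (intro conjI ballI allI impI)
    show "finite (insert 0 T)" "{x. mp x - mm x \<noteq> 0} \<subseteq> insert 0 T" "finite E"
      using T out by (auto simp: E_def)
    fix e assume "e \<in> E"
    then show "e \<subseteq> insert 0 T" "card e = 2" using T by (auto simp: E_def card_2_iff)
  next
    fix x y assume "{x, y} \<in> E"
    then have "x \<in> T \<and> y = 0 \<or> y \<in> T \<and> x = 0" by (auto simp: E_def doubleton_eq_iff)
    then show "m x y \<noteq> 0" "m x y = - m y x" using T u[of x] u[of y] by (auto simp: m_def)
  next
    fix z
    have "flow_div E m z = (\<Sum>x\<in>T. edge_val (unit_div m z) {x, 0})"
      by (simp add: flow_div_alt E_def sum.reindex[OF inj])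
    also have "\<dots> = (\<Sum>x\<in>T. (mm x - mp x) * (if z = 0 then 1 else 0) - (if x = z then mm x - mp x else 0))"
    proof (intro sum.cong refl)
      fix x assume x: "x \<in> T"
      then have "x \<noteq> 0" using T by auto
      then show "edge_val (unit_div m z) {x, 0}
          = (mm x - mp x) * (if z = 0 then 1 else 0) - (if x = z then mm x - mp x else 0)"
        using edge_val_unit_div[of m x 0 z, OF anti[OF x]] by (auto simp: unit_div_def m_def)
    qed
    also have "\<dots> = (\<Sum>x\<in>T. mm x - mp x) * (if z = 0 then 1 else 0) - (\<Sum>x\<in>T. if x = z then mm x - mp x else 0)"
      by (subst sum_subtractf) (simp only: sum_distrib_right)
    also have "\<dots> = mp z - mm z" using tot T out by simp
    finally show "mp z - mm z = flow_div E m z" by simp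
  qed
qed

text \<open>Sources at \<open>- a i\<close>, the sink at the sum of the \<open>a i\<close> and the
  hub at 0 align every edge with its calibrating vector, so the calibration bound is
  attained.\<close>

lemma equiangular_star_minimal:
  fixes a :: "'n::finite \<Rightarrow> 'a::euclidean_space"
  assumes d2: "2 \<le> CARD('n)" and p: "1/2 \<le> p" "p < 1"
    and a: "\<And>i j. a i \<bullet> a j = (if i = j then 1 else common_inner p (real CARD('n)))"
  shows "\<exists>(mp :: 'a \<Rightarrow> real) mm V E m b.
              fin_meas mp \<and> fin_meas mm \<and> total_mass mp = total_mass mm \<and>
              minimal_flow p mp mm V E m \<and>
              branching_point mp mm V b \<and> card E = CARD('n) + 1 \<and> (\<forall>e\<in>E. b \<in> e)"
proof -
  define d where "d = real CARD('n)"
  define g where "g = common_inner p d"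
  have d: "d = real CARD('n)" "2 \<le> d" using d2 by (auto simp: d_def)
  have ag: "a i \<bullet> a j = (if i = j then 1 else g)" for i j using a by (simp add: g_def d_def)
  note cal = equiangular_calibration[OF d p g_def ag] and g = common_inner_bounds[OF d(2) p, folded g_def]
  define y where "y = (\<lambda>i. - a i)"
  define y0 where "y0 = (\<Sum>i\<in>UNIV. a i)"
  define mp :: "'a \<Rightarrow> real" where "mp = (\<lambda>x. if x = y0 then real CARD('n) else 0)"
  define mm :: "'a \<Rightarrow> real" where "mm = (\<lambda>x. if x \<in> range y then 1 else 0)"
  define T where "T = insert y0 (range y)"
  have na: "norm (a i) = 1" for i using ag[of i i] by (simp add: norm_eq_1)
  have y00: "y0 \<noteq> 0" using cal(1) d by (auto simp: y0_def)
  have inj: "inj y"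
  proof (rule injI, rule ccontr)
    fix i j assume ij: "y i = y j" "i \<noteq> j"
    then have "a i = a j" by (simp add: y_def)
    then show False using ag[of i j] ag[of i i] ij g(2) by simp
  qed
  have y0y: "y0 \<notin> range y"
  proof
    assume "y0 \<in> range y"
    then obtain j where j: "y0 = - a j" by (auto simp: y_def)
    have "0 \<le> y0 \<bullet> a j" unfolding y0_def inner_sum_left using ag g(1) by (intro sum_nonneg) auto
    then show False using j ag[of j j] by simp
  qed
  have zT: "0 \<notin> T"
  proof -
    have "y i \<noteq> 0" for i using na[of i] by (auto simp: y_def)
    then show ?thesis using y00 by (auto simp: T_def)
  qed
  have sT: "(\<Sum>x\<in>T. F x) = F y0 + (\<Sum>i\<in>UNIV. F (y i))" for F :: "'a \<Rightarrow> real"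
    unfolding T_def using y0y by (simp add: sum.reindex[OF inj])
  have val: "mm y0 = 0" "mp y0 = d" "mm (y i) = 1" "mp (y i) = 0" for i
    using y0y by (auto simp: mm_def mp_def d_def)
  have supp: "msupp mp = {y0}" "msupp mm = range y" by (auto simp: msupp_def mp_def mm_def)
  define E where "E = (\<lambda>x. {x, 0::'a}) ` T"
  define m where "m = (\<lambda>x y. if y = 0 then mm x - mp x else if x = 0 then mp y - mm y else 0)"
  have finT: "finite T" by (simp add: T_def)
  have u: "mm x - mp x \<noteq> 0" if "x \<in> T" for x using that d by (auto simp: T_def val)
  have out: "mp x = mm x" if "x \<notin> T" for x using that by (auto simp: T_def mp_def mm_def)
  have tot: "(\<Sum>x\<in>T. mm x - mp x) = 0" by (simp add: sT val d_def)
  note star = star_flow[of T mm mp, OF finT zT u out tot, folded E_def m_def]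
  have fl: "is_flow mp mm (insert 0 T) E m" and cardE: "card E = card T"
    and gil: "gilbert p E m = (\<Sum>x\<in>T. \<bar>mm x - mp x\<bar> powr p * norm x)"
    using star by blast+
  have "gilbert p E m = d powr p * d powr p + d"
  proof -
    have "norm (y i) = 1" for i by (simp add: y_def na)
    then show ?thesis using d cal(1) by (simp add: gil sT val y0_def[symmetric])
  qed
  also have "\<dots> = (\<Sum>i\<in>UNIV. a i \<bullet> (y0 - y i))"
  proof -
    have "(\<Sum>i\<in>UNIV. a i \<bullet> (y0 - y i)) = y0 \<bullet> y0 + d"
      by (simp add: y_def inner_add_right sum.distrib ag d_def inner_sum_left[symmetric] y0_def[symmetric])
    also have "y0 \<bullet> y0 = d powr p * d powr p"
      using cal(1) by (simp add: y0_def dot_square_norm power2_eq_square)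
    finally show ?thesis by simp
  qed
  finally have cost: "gilbert p E m = (\<Sum>i\<in>UNIV. a i \<bullet> (y0 - y i))" .
  have "minimal_flow p mp mm (insert 0 T) E m"
    unfolding minimal_flow_def cost
  proof (intro conjI fl allI impI)
    fix V' E' m' assume "is_flow mp mm V' E' m'"
    then show "(\<Sum>i\<in>UNIV. a i \<bullet> (y0 - y i)) \<le> gilbert p E' m'"
      using p by (intro flow_ge_calibration[OF cal(2) _ _ inj y0y mp_def mm_def]) auto
  qed
  moreover have "fin_meas mp" "fin_meas mm" using supp by (auto simp: fin_meas_def msupp_def mp_def mm_def)
  moreover have "total_mass mp = total_mass mm"
    by (simp add: total_mass_def supp val sum.reindex[OF inj] d_def)
  moreover have "branching_point mp mm (insert 0 T) 0"
    using zT by (simp add: branching_point_def terminals_def supp T_def)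
  moreover have "card E = CARD('n) + 1"
  proof -
    have "card T = CARD('n) + 1" using y0y by (simp add: T_def card_image[OF inj])
    then show ?thesis using cardE by (simp only:)
  qed
  moreover have "\<forall>e\<in>E. 0 \<in> e" by (auto simp: E_def)
  ultimately show ?thesis by blast
qed

section \<open>Degrees of branching points\<close>

text \<open>Conservation of mass excludes degree 1, and one of the two star bounds excludes degrees
  above 3.\<close>

lemma branching_point_degree:
  fixes mp mm :: "'a::euclidean_space \<Rightarrow> real"
  assumes p: "0 < p" "p < 1" and dim: "DIM('a) = 2 \<or> p < 1/2"
    and mf: "minimal_flow p mp mm V E m" and bp: "branching_point mp mm V v"
    and deg: "degree E v \<noteq> 0" "degree E v \<noteq> 2"
  shows "degree E v = 3"
proof -
  have fl: "is_flow mp mm V E m" using mf by (simp add: minimal_flow_def)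
  have v: "v \<in> V" and mv: "mp v = mm v"
    using bp by (auto simp: branching_point_def terminals_def msupp_def)
  define N where "N = nbrs E v"
  define a where "a = (\<lambda>x. \<bar>m v x\<bar> powr p *\<^sub>R sgn (x - v))"
  have fin: "finite N" and vN: "v \<notin> N" and deg_eq: "degree E v = card N"
    using nbrs_props[OF fl, of v] by (auto simp: N_def)
  have ne: "m v x \<noteq> 0" if "x \<in> N" for x
    using is_flowD(4)[OF fl, of v x] that by (simp add: N_def nbrs_def)
  have zero: "sum (m v) N = 0" using nbrs_sum[OF fl mv] by (simp add: N_def)
  have cal: "norm (sum a S) \<le> \<bar>sum (m v) S\<bar> powr p" if "S \<subseteq> N" for S
    using minimal_flow_calibrated[OF mf _ v, of S] that by (simp add: N_def a_def)
  have nrm: "norm (a x) = \<bar>m v x\<bar> powr p" if "x \<in> N" for x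
    using that vN by (auto simp: a_def norm_sgn)
  have "card N \<noteq> 1"
  proof
    assume "card N = 1"
    then obtain x where "N = {x}" by (auto simp: card_1_singleton_iff)
    then show False using zero ne[of x] by simp
  qed
  moreover have "card N \<le> 3"
  proof (cases "p < 1/2")
    case True
    then show ?thesis using star_degree_le_3_of_subhalf[OF p(1) True fin ne zero cal nrm] by blast
  next
    case False
    then have "DIM('a) = DIM(complex)" using dim by simp
    \<comment> \<open>A linear isometry onto the complex plane makes arguments of vectors
      available.\<close>
    then obtain f :: "'a \<Rightarrow> complex" where f: "linear f" "\<And>x. norm (f x) = norm x"
      by (rule isomorphisms_UNIV_UNIV) blast
    show ?thesis
    proof (rule planar_star_degree_le_3[OF p fin ne zero, of "f \<circ> a"])
      fix i j assume ij: "i \<in> N" "j \<in> N" "i \<noteq> j"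
      have "norm ((f \<circ> a) i + (f \<circ> a) j) = norm (a i + a j)"
        using linear_add[OF f(1), of "a i" "a j"] f(2)[of "a i + a j"] by simp
      then show "norm ((f \<circ> a) i + (f \<circ> a) j) \<le> \<bar>m v i + m v j\<bar> powr p"
        using cal[of "{i, j}"] ij by simp
    qed (use nrm f(2) in auto)
  qed
  ultimately show ?thesis using deg deg_eq by simp
qed

text \<open>The condition on degree 2 expresses that such branching points have been merged away.
  Degree 0 is set apart because \<open>V\<close> may contain isolated points.\<close>

theorem theorem2:
  fixes p :: real
  assumes "CARD('n::finite) \<ge> 2" and "0 < p" and "p < 1"
  shows "(CARD('n) = 2 \<or> p < 1/2 \<longrightarrow>
           (\<forall>(mp :: real^'n \<Rightarrow> real) mm V E m.
              fin_meas mp \<and> fin_meas mm \<and> total_mass mp = total_mass mm \<and>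
              minimal_flow p mp mm V E m \<and>
              (\<forall>v. branching_point mp mm V v \<longrightarrow> degree E v \<noteq> 2) \<longrightarrow>
              (\<forall>v. branching_point mp mm V v \<and> degree E v \<noteq> 0 \<longrightarrow> degree E v = 3)))
       \<and> (1/2 \<le> p \<longrightarrow>
           (\<exists>(mp :: real^'n \<Rightarrow> real) mm V E m b.
              fin_meas mp \<and> fin_meas mm \<and> total_mass mp = total_mass mm \<and>
              minimal_flow p mp mm V E m \<and>
              branching_point mp mm V b \<and> card E = CARD('n) + 1 \<and> (\<forall>e\<in>E. b \<in> e)))"
proof (intro conjI impI allI)
  fix mp mm :: "real^'n \<Rightarrow> real" and V E m v
  assume dim: "CARD('n) = 2 \<or> p < 1/2"
    and flow: "fin_meas mp \<and> fin_meas mm \<and> total_mass mp = total_mass mm \<and> minimal_flow p mp mm V E m \<and>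
      (\<forall>v. branching_point mp mm V v \<longrightarrow> degree E v \<noteq> 2)"
    and v: "branching_point mp mm V v \<and> degree E v \<noteq> 0"
  show "degree E v = 3"
    by (rule branching_point_degree[OF assms(2,3)]) (use dim flow v in auto)
next
  assume p: "1/2 \<le> p"
  have "2 \<le> real CARD('n)" using assms(1) by simp
  note g = common_inner_bounds[OF this p assms(3)]
  obtain a :: "'n \<Rightarrow> real^'n" where "\<And>i j. a i \<bullet> a j = (if i = j then 1 else common_inner p (real CARD('n)))"
    using equiangular_exists[OF g] by blast
  then show "\<exists>(mp :: real^'n \<Rightarrow> real) mm V E m b.
      fin_meas mp \<and> fin_meas mm \<and> total_mass mp = total_mass mm \<and> minimal_flow p mp mm V E m \<and>
      branching_point mp mm V b \<and> card E = CARD('n) + 1 \<and> (\<forall>e\<in>E. b \<in> e)"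
    by (rule equiangular_star_minimal[OF assms(1) p assms(3)])
qed

end
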